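(* Let $N \geq 3$, let $\mathbb{H}^N$ be the $N$-dimensional hyperbolic space, fix a point $o\in\mathbb{H}^N$ and set $r=r(x):=\varrho(x,o)$, the geodesic distance from $o$. Then for all $u \in C_c^\infty(\mathbb{H}^N)$ $$\int_{\mathbb{H}^N} |\nabla_{\mathbb{H}^N} u|^2 \, dv_{\mathbb{H}^N} - \frac{(N-1)^2}{4} \int_{\mathbb{H}^N} u^2 \, dv_{\mathbb{H}^N} \geq \frac{1}{4} \int_{\mathbb{H}^N} \frac{u^2}{r^2} \, dv_{\mathbb{H}^N} + \frac{(N-1)(N-3)}{4} \int_{\mathbb{H}^N} \frac{u^2}{\sinh^2 r} \, dv_{\mathbb{H}^N}.$$ Moreover, the operator $$H = -\Delta_{\mathbb{H}^N} - \frac{(N-1)^2}{4} - \frac{1}{4r^2} - \frac{(N-1)(N-3)}{4} \frac{1}{\sinh^2 r}$$ is critical in $\mathbb{H}^N\setminus\{o\}$; that is, the inequality $$\int_{\mathbb{H}^N} |\nabla_{\mathbb{H}^N} u|^2 \, dv_{\mathbb{H}^N} - \frac{(N-1)^2}{4} \int_{\mathbb{H}^N} u^2 \, dv_{\mathbb{H}^N} \geq \int_{\mathbb{H}^N} V u^2 \, dv_{\mathbb{H}^N} \quad \forall u \in C_c^\infty(\mathbb{H}^N\setminus\{o\})$$ is not valid for any $V > \frac{1}{4r^2} + \frac{(N-1)(N-3)}{4\sinh^2 r}$. In particular: no inequality of the form $\int_{\mathbb{H}^N} |\nabla_{\mathbb{H}^N} u|^2 dv_{\mathbb{H}^N} -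 \frac{(N-1)^2}{4}\int_{\mathbb{H}^N} u^2 dv_{\mathbb{H}^N} \ge c\int_{\mathbb{H}^N} \frac{u^2}{r^2} dv_{\mathbb{H}^N}$ holds for all $u\in C_c^\infty(\mathbb{H}^N)$ when $c>1/4$; and for every $\varepsilon>0$, no inequality of the form $$\int_{\mathbb{H}^N} |\nabla_{\mathbb{H}^N} u|^2 dv_{\mathbb{H}^N} - \frac{(N-1)^2}{4}\int_{\mathbb{H}^N} u^2 dv_{\mathbb{H}^N} \ge \frac14\int_{\mathbb{H}^N} \frac{u^2}{r^2} dv_{\mathbb{H}^N} + c\int_{\mathbb{H}^N} \frac{u^2}{\sinh^2 r} dv_{\mathbb{H}^N}$$ holds for all $u\in C_c^\infty(B_\varepsilon)$ when $c>(N-1)(N-3)/4$, where $B_\varepsilon=\{x\in\mathbb{H}^N:\varrho(x,o)<\varepsilon\}$.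
   Context: $\nabla_{\mathbb{H}^N}$, $\Delta_{\mathbb{H}^N}$, $dv_{\mathbb{H}^N}$ denote the Riemannian gradient, Laplace–Beltrami operator and volume measure of $\mathbb{H}^N$. A Schrödinger operator $P=-\Delta-V$ on a domain $\Omega$ is called critical in $\Omega$ (in the sense of Devyver–Fraas–Pinchover) if its quadratic form is nonnegative on $C_c^\infty(\Omega)$ and there is no nonnegative, not identically zero weight $W$ such that $\int_\Omega|\nabla u|^2-\int_\Omega Vu^2\ge\int_\Omega Wu^2$ for all $u\in C_c^\infty(\Omega)$. *)

theory Defs
  imports "HOL-Analysis.Analysis"
begin

text \<open>Model: the Poincare ball model of hyperbolic space H^N, i.e. the open unit
ball of real^'n (N = CARD('n)) with metric g = (2/(1-|x|^2))^2 times the Euclidean metric.\<close>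

definition hball :: "(real^'n) set" where
  "hball = ball 0 1"

definition hdist :: "real^'n \<Rightarrow> real^'n \<Rightarrow> real" where
  "hdist x y = arcosh (1 + 2 * (norm (x - y))^2 / ((1 - (norm x)^2) * (1 - (norm y)^2)))"

definition hdens :: "real^'n \<Rightarrow> real" where
  "hdens x = (2 / (1 - (norm x)^2)) ^ CARD('n)"

definition pderiv_i :: "(real^'n \<Rightarrow> real) \<Rightarrow> 'n \<Rightarrow> real^'n \<Rightarrow> real" where
  "pderiv_i f i x = frechet_derivative f (at x) (axis i 1)"

fun Ck :: "nat \<Rightarrow> (real^'n \<Rightarrow> real) \<Rightarrow> bool" where
  "Ck 0 f = continuous_on UNIV f"
| "Ck (Suc k) f = (f differentiable_on UNIV \<and> continuous_on UNIV f \<and> (\<forall>i. Ck k (pderiv_i f i)))"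

definition smooth_fun :: "(real^'n \<Rightarrow> real) \<Rightarrow> bool" where
  "smooth_fun f = (\<forall>k. Ck k f)"

text \<open>C_c^infinity(U) for an open U contained in the ball: smooth functions whose
support (closure of the nonzero set) is compact and contained in U (extended by 0).\<close>
definition test_funs :: "(real^'n) set \<Rightarrow> (real^'n \<Rightarrow> real) set" where
  "test_funs U = {u. smooth_fun u \<and> compact (closure {x. u x \<noteq> 0}) \<and> closure {x. u x \<noteq> 0} \<subseteq> U}"

definition hgrad_sq :: "(real^'n \<Rightarrow> real) \<Rightarrow> real^'n \<Rightarrow> real" where
  "hgrad_sq u x = ((1 - (norm x)^2) / 2)^2 * (\<Sum>i\<in>UNIV. (pderiv_i u i x)^2)"

text \<open>Integral with respect to the hyperbolic volume measure (functions vanishing outside the ball).\<close>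
definition hint :: "(real^'n \<Rightarrow> real) \<Rightarrow> real" where
  "hint f = integral\<^sup>L lborel (\<lambda>x. f x * hdens x)"

definition hQ :: "(real^'n \<Rightarrow> real) \<Rightarrow> (real^'n \<Rightarrow> real) \<Rightarrow> real" where
  "hQ V u = hint (hgrad_sq u) - hint (\<lambda>x. V x * (u x)^2)"

text \<open>Criticality (Devyver-Fraas-Pinchover) of -Delta_H - V in Omega.  The weight W is a
nonnegative measurable function not vanishing a.e. on Omega; the inequality with the
nonnegative integral means in particular that the integral of W u^2 is finite.\<close>
definition critical :: "(real^'n) set \<Rightarrow> (real^'n \<Rightarrow> real) \<Rightarrow> bool" where
  "critical \<Omega> V \<longleftrightarrow>
     (\<forall>u\<in>test_funs \<Omega>. 0 \<le> hQ V u) \<and>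
     \<not> (\<exists>W. W \<in> borel_measurable lborel \<and> (\<forall>x\<in>\<Omega>. 0 \<le> W x) \<and>
            \<not> (AE x in lborel. x \<in> \<Omega> \<longrightarrow> W x = 0) \<and>
            (\<forall>u\<in>test_funs \<Omega>.
               (\<integral>\<^sup>+ x. ennreal (W x * (u x)^2 * hdens x) \<partial>lborel) \<le> ennreal (hQ V u)))"

end

theory Submission
  imports Defs "HOL-Real_Asymp.Real_Asymp"
begin

text \<open>Let \<open>\<phi> = r powr (1/2) * sinh r powr (- (N - 1) / 2)\<close>, a positive solution of \<open>H \<phi> = 0\<close> away
  from the pole, and \<open>g = \<phi>' / \<phi>\<close>. Expanding \<open>|\<nabla>u - u g \<nabla>r|\<^sup>2 \<ge> 0\<close> and integrating the
  cross term by parts gives the inequality. For \<open>u = \<phi> \<chi>(r)\<close> the deficit is exactly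
  \<open>\<integral> \<phi>\<^sup>2 \<chi>'(r)\<^sup>2 dv\<close>, that is, up to the area of the sphere, \<open>\<integral> (d\<chi>/ds)\<^sup>2 ds\<close> in the variable
  \<open>s = ln r\<close>; stretching a fixed bump by a factor \<open>k\<close> in \<open>s\<close> makes it of order \<open>1 / k\<close>, whereas
  \<open>\<integral> u\<^sup>2 / r\<^sup>2 dv\<close> is of order \<open>k\<close>. Centring the bump at \<open>0\<close>, \<open>2 k\<close> and \<open>- 2 k\<close> yields
  criticality and the two optimality statements.\<close>

subsection \<open>Differentiability classes\<close>

fun Ck_on :: "nat \<Rightarrow> 'a::euclidean_space set \<Rightarrow> ('a \<Rightarrow> real) \<Rightarrow> bool" where
  "Ck_on 0 S f \<longleftrightarrow> continuous_on S f"
| "Ck_on (Suc k) S f \<longleftrightarrow> (\<exists>G. (\<forall>x\<in>S. GDERIV f x :> G x) \<and> (\<forall>b\<in>Basis. Ck_on k S (\<lambda>x. G x \<bullet> b)))"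

lemma GDERIV_unique: "GDERIV f x :> D \<Longrightarrow> GDERIV f x :> E \<Longrightarrow> D = E"
  unfolding gderiv_def by (drule (1) has_derivative_unique) (metis inner_commute vector_eq_rdot)

lemma GDERIV_imp_isCont: "GDERIV f x :> D \<Longrightarrow> isCont f x"
  unfolding gderiv_def by (rule has_derivative_continuous)

lemma GDERIV_transform_within_open:
  "GDERIV f x :> D \<Longrightarrow> open S \<Longrightarrow> x \<in> S \<Longrightarrow> (\<And>y. y \<in> S \<Longrightarrow> f y = g y) \<Longrightarrow> GDERIV g x :> D"
  unfolding gderiv_def by (rule has_derivative_transform_within_open)

lemma GDERIV_inner: "GDERIV (\<lambda>x. x \<bullet> a) x :> a"
  unfolding gderiv_def by (auto intro!: derivative_eq_intros)

lemma GDERIV_norm_diff_sq: "GDERIV (\<lambda>x. (norm (x - a))\<^sup>2) x :> 2 *\<^sub>R (x - a)"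
  unfolding gderiv_def power2_norm_eq_inner
  by (auto intro!: derivative_eq_intros simp: inner_commute)

lemma Ck_on_cong:
  assumes "open S" "\<And>x. x \<in> S \<Longrightarrow> f x = g x"
  shows "Ck_on k S f \<longleftrightarrow> Ck_on k S g"
proof (cases k)
  case 0
  then show ?thesis using assms(2) by (auto intro: continuous_on_eq)
next
  case (Suc j)
  have "GDERIV f x :> D \<longleftrightarrow> GDERIV g x :> D" if "x \<in> S" for x D
    using GDERIV_transform_within_open[OF _ assms(1) that] assms(2) by metis
  with Suc show ?thesis by simp
qed

lemma Ck_on_imp_continuous_on: "Ck_on k S f \<Longrightarrow> continuous_on S f"
proof (cases k)
  case (Suc j)
  assume "Ck_on k S f"
  with Suc have "\<forall>x\<in>S. isCont f x" by (auto simp del: gderiv_deriv dest: GDERIV_imp_isCont)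
  then show ?thesis by (rule continuous_at_imp_continuous_on)
qed simp

lemma Ck_on_SucD: "Ck_on (Suc k) S f \<Longrightarrow> Ck_on k S f"
proof (induction k arbitrary: f)
  case 0
  from Ck_on_imp_continuous_on[OF this] show ?case by simp
next
  case (Suc k)
  then obtain G where "\<forall>x\<in>S. GDERIV f x :> G x" "\<forall>b\<in>Basis. Ck_on (Suc k) S (\<lambda>x. G x \<bullet> b)"
    by (auto simp only: Ck_on.simps(2)[of "Suc k"])
  with Suc.IH show ?case by auto
qed

lemma Ck_on_subset: "Ck_on k T f \<Longrightarrow> S \<subseteq> T \<Longrightarrow> Ck_on k S f"
  by (induction k arbitrary: f) (auto intro: continuous_on_subset, blast)

lemma Ck_on_const: "Ck_on k S (\<lambda>x. c)"
proof (induction k arbitrary: c)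
  case (Suc k)
  show ?case
    unfolding Ck_on.simps using Suc by (intro exI[of _ "\<lambda>x. 0"]) (auto simp: GDERIV_const)
qed simp

lemma Ck_on_inner: "Ck_on k S (\<lambda>x. x \<bullet> a)"
proof (cases k)
  case (Suc j)
  then show ?thesis
    by (auto intro!: exI[of _ "\<lambda>x. a"] GDERIV_inner Ck_on_const)
qed (auto intro: continuous_intros)

lemma Ck_on_add: "Ck_on k S f \<Longrightarrow> Ck_on k S g \<Longrightarrow> Ck_on k S (\<lambda>x. f x + g x)"
proof (induction k arbitrary: f g)
  case 0
  then show ?case by (auto intro: continuous_intros)
next
  case (Suc k)
  then obtain F G where "\<forall>x\<in>S. GDERIV f x :> F x" "\<forall>b\<in>Basis. Ck_on k S (\<lambda>x. F x \<bullet> b)"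
    "\<forall>x\<in>S. GDERIV g x :> G x" "\<forall>b\<in>Basis. Ck_on k S (\<lambda>x. G x \<bullet> b)" by auto
  then show ?case
    by (auto intro!: exI[of _ "\<lambda>x. F x + G x"] GDERIV_add Suc.IH simp: inner_add_left)
qed

lemma Ck_on_mult: "Ck_on k S f \<Longrightarrow> Ck_on k S g \<Longrightarrow> Ck_on k S (\<lambda>x. f x * g x)"
proof (induction k arbitrary: f g)
  case 0
  then show ?case by (auto intro: continuous_intros)
next
  case (Suc k)
  then obtain F G where "\<forall>x\<in>S. GDERIV f x :> F x" "\<forall>b\<in>Basis. Ck_on k S (\<lambda>x. F x \<bullet> b)"
    "\<forall>x\<in>S. GDERIV g x :> G x" "\<forall>b\<in>Basis. Ck_on k S (\<lambda>x. G x \<bullet> b)" by auto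
  then show ?case
    using Ck_on_SucD[OF Suc.prems(1)] Ck_on_SucD[OF Suc.prems(2)]
    by (auto intro!: exI[of _ "\<lambda>x. f x *\<^sub>R G x + g x *\<^sub>R F x"] GDERIV_mult Ck_on_add Suc.IH
        simp: inner_add_left simp del: gderiv_deriv)
qed

lemma Ck_on_compose:
  assumes "\<And>x. x \<in> S \<Longrightarrow> f x \<in> I"
  shows "Ck_on k I h \<Longrightarrow> Ck_on k S f \<Longrightarrow> Ck_on k S (\<lambda>x. h (f x))"
proof (induction k arbitrary: h)
  case 0
  then show ?case using assms by (auto intro: continuous_on_compose2)
next
  case (Suc k)
  then obtain h' F where h': "\<forall>t\<in>I. DERIV h t :> h' t" "Ck_on k I h'"
    and F: "\<forall>x\<in>S. GDERIV f x :> F x" "\<forall>b\<in>Basis. Ck_on k S (\<lambda>x. F x \<bullet> b)" by auto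
  have "Ck_on k S (\<lambda>x. h' (f x))"
    by (rule Suc.IH[OF h'(2) Ck_on_SucD[OF Suc.prems(2)]])
  moreover have "GDERIV (\<lambda>x. h (f x)) x :> h' (f x) *\<^sub>R F x" if "x \<in> S" for x
    using F(1) h'(1) assms that by (blast intro: GDERIV_DERIV_compose)
  ultimately show ?case
    using F(2) by (auto intro!: exI[of _ "\<lambda>x. h' (f x) *\<^sub>R F x"] Ck_on_mult)
qed

lemma Ck_on_uminus: "Ck_on k S f \<Longrightarrow> Ck_on k S (\<lambda>x. - f x)"
  using Ck_on_mult[OF Ck_on_const, of k S f "-1"] by simp

lemma Ck_on_diff: "Ck_on k S f \<Longrightarrow> Ck_on k S g \<Longrightarrow> Ck_on k S (\<lambda>x. f x - g x)"
  using Ck_on_add[OF _ Ck_on_uminus, of k S f g] by simp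

lemma Ck_on_power: "Ck_on k S f \<Longrightarrow> Ck_on k S (\<lambda>x. f x ^ j)"
  by (induction j) (auto intro: Ck_on_mult Ck_on_const)

lemma Ck_on_norm_diff_sq: "Ck_on k S (\<lambda>x. (norm (x - a))\<^sup>2)"
proof (cases k)
  case (Suc j)
  have "Ck_on j S (\<lambda>x. 2 * (x \<bullet> b - a \<bullet> b))" for b
    by (intro Ck_on_mult Ck_on_diff Ck_on_inner Ck_on_const)
  then show ?thesis
    unfolding Suc by (auto intro!: exI[of _ "\<lambda>x. 2 *\<^sub>R (x - a)"] GDERIV_norm_diff_sq
        simp: inner_diff_left)
qed (auto intro!: continuous_intros)

lemma Ck_on_extend_by_zero:
  assumes S: "open S" and K: "closed K" "K \<subseteq> S"
  shows "Ck_on k S f \<Longrightarrow> (\<And>x. x \<notin> K \<Longrightarrow> f x = 0) \<Longrightarrow> Ck_on k UNIV f"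
proof (induction k arbitrary: f)
  case 0
  have "continuous_on (- K) f"
    using 0(2) by (intro continuous_on_eq[OF continuous_on_const]) simp
  then have "continuous_on (S \<union> - K) f"
    using 0(1) S K(1) by (intro continuous_on_open_Un) auto
  moreover have "S \<union> - K = UNIV" using K(2) by auto
  ultimately show ?case by simp
next
  case (Suc k)
  obtain F where F: "\<And>x. x \<in> S \<Longrightarrow> GDERIV f x :> F x" "\<And>b. b \<in> Basis \<Longrightarrow> Ck_on k S (\<lambda>x. F x \<bullet> b)"
    using Suc.prems(1) by auto
  define G where "G x = (if x \<in> K then F x else 0)" for x
  have outside: "GDERIV f x :> 0" if "x \<notin> K" for x
    by (rule GDERIV_transform_within_open[OF GDERIV_const, of "- K"]) (use K(1) that Suc.prems(2) in auto)
  then have G: "GDERIV f x :> G x" for x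
    using F(1) K(2) by (auto simp: G_def simp del: gderiv_deriv)
  have "Ck_on k UNIV (\<lambda>x. G x \<bullet> b)" if "b \<in> Basis" for b
  proof (rule Suc.IH)
    have "F x = G x" if "x \<in> S" for x
      using GDERIV_unique[OF F(1)[OF that] G] .
    then show "Ck_on k S (\<lambda>x. G x \<bullet> b)"
      using F(2)[OF \<open>b \<in> Basis\<close>] Ck_on_cong[OF S, of "\<lambda>x. F x \<bullet> b" "\<lambda>x. G x \<bullet> b"] by simp
  qed (simp add: G_def)
  with G show ?case by (auto simp del: gderiv_deriv)
qed

subsection \<open>Smooth functions of one real variable\<close>

lemma Ck_on_derivI:
  "(\<And>t. t \<in> S \<Longrightarrow> (h has_real_derivative h' t) (at t)) \<Longrightarrow> Ck_on k S h' \<Longrightarrow> Ck_on (Suc k) S h"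
  by (auto intro!: exI[of _ h'])

lemma Ck_on_powr: "Ck_on k {0<..} (\<lambda>t::real. t powr a)"
proof (induction k arbitrary: a)
  case (Suc k)
  show ?case
    by (rule Ck_on_derivI[OF has_real_derivative_powr]) (auto intro: Ck_on_mult Ck_on_const Suc)
qed (auto intro!: continuous_intros)

lemma Ck_on_inverse: "Ck_on k {0<..} (inverse :: real \<Rightarrow> real)"
  using Ck_on_powr[of k "- 1"] Ck_on_cong[of "{0<..}" inverse "\<lambda>t::real. t powr - 1" k]
  by (simp add: powr_minus)

lemma Ck_on_ln: "Ck_on k {0<..} (ln :: real \<Rightarrow> real)"
proof (cases k)
  case (Suc j)
  show ?thesis
    unfolding Suc by (rule Ck_on_derivI[OF _ Ck_on_inverse]) (simp add: DERIV_ln)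
qed (auto intro!: continuous_intros)

lemma Ck_on_sinh_cosh: "Ck_on k S (sinh :: real \<Rightarrow> real)" "Ck_on k S (cosh :: real \<Rightarrow> real)"
proof -
  have "Ck_on k S (sinh :: real \<Rightarrow> real) \<and> Ck_on k S (cosh :: real \<Rightarrow> real)"
  proof (induction k)
    case (Suc k)
    then show ?case
      by (auto intro!: Ck_on_derivI[of S sinh cosh] Ck_on_derivI[of S cosh sinh] derivative_eq_intros
          simp del: Ck_on.simps)
  qed (auto intro: continuous_intros)
  then show "Ck_on k S (sinh :: real \<Rightarrow> real)" "Ck_on k S (cosh :: real \<Rightarrow> real)" by auto
qed

lemma Ck_on_arcosh: "Ck_on k {1<..} (arcosh :: real \<Rightarrow> real)"
proof (cases k)
  case (Suc j)
  have gt: "0 < t\<^sup>2 - 1" if "t \<in> {1<..}" for t :: real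
    using that by (simp add: power2_eq_square less_1_mult)
  have "(arcosh has_real_derivative (t\<^sup>2 - 1) powr - (1 / 2)) (at t)" if "t \<in> {1<..}" for t :: real
  proof -
    have "(t\<^sup>2 - 1) powr - (1 / 2) = 1 / sqrt (t\<^sup>2 - 1)"
      using gt[OF that] by (simp add: powr_minus_divide powr_half_sqrt)
    then show ?thesis using arcosh_real_has_field_derivative[of t UNIV] that by simp
  qed
  moreover have "Ck_on j {1<..} (\<lambda>t::real. (t\<^sup>2 - 1) powr - (1 / 2))"
    using gt Ck_on_norm_diff_sq[of j "{1<..}" "0 :: real"]
    by (intro Ck_on_compose[OF _ Ck_on_powr] Ck_on_diff Ck_on_const) auto
  ultimately show ?thesis
    unfolding Suc by (rule Ck_on_derivI)
qed (auto intro!: continuous_intros)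

definition flat_exp :: "nat \<Rightarrow> real \<Rightarrow> real" where
  "flat_exp j t = (if t > 0 then exp (- inverse t) / t ^ j else 0)"

lemma flat_exp_nonneg: "0 \<le> flat_exp j t"
  by (simp add: flat_exp_def)

lemma flat_exp_pos: "0 < t \<Longrightarrow> 0 < flat_exp j t"
  by (simp add: flat_exp_def)

lemma flat_exp_eq_0: "t \<le> 0 \<Longrightarrow> flat_exp j t = 0"
  by (simp add: flat_exp_def)

lemma flat_exp_0_le_1: "flat_exp 0 t \<le> 1"
  by (simp add: flat_exp_def)

lemma flat_exp_0_mono: "s \<le> t \<Longrightarrow> flat_exp 0 s \<le> flat_exp 0 t"
  by (auto simp: flat_exp_def le_imp_inverse_le)

lemma flat_exp_0_tendsto_1: "(flat_exp 0 \<longlongrightarrow> 1) at_top"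
proof (rule Lim_transform_eventually)
  show "((\<lambda>t::real. exp (- inverse t)) \<longlongrightarrow> 1) at_top" by real_asymp
  show "\<forall>\<^sub>F t in at_top. exp (- inverse t) = flat_exp 0 t"
    using eventually_gt_at_top[of 0] by eventually_elim (simp add: flat_exp_def)
qed

lemma flat_exp_difference_quotient_tendsto_0: "((\<lambda>t. flat_exp j t / t) \<longlongrightarrow> 0) (at 0)"
proof (rule filterlim_split_at)
  show "((\<lambda>t. flat_exp j t / t) \<longlongrightarrow> 0) (at_left 0)"
    by (rule Lim_transform_eventually[OF tendsto_const])
      (auto simp: flat_exp_def eventually_at_filter)
  have "((\<lambda>s::real. s ^ Suc j / exp s) \<longlongrightarrow> 0) at_top"
    by (rule tendsto_power_div_exp_0)
  then have "((\<lambda>t::real. inverse t ^ Suc j / exp (inverse t)) \<longlongrightarrow> 0) (at_right 0)"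
    by (rule filterlim_compose[OF _ filterlim_inverse_at_top_right])
  moreover have "\<forall>\<^sub>F t in at_right 0. inverse t ^ Suc j / exp (inverse t) = flat_exp j t / t"
    using eventually_at_right_less[of "0::real"]
    by eventually_elim (simp add: flat_exp_def exp_minus field_simps)
  ultimately show "((\<lambda>t. flat_exp j t / t) \<longlongrightarrow> 0) (at_right 0)"
    by (rule Lim_transform_eventually)
qed

lemma flat_exp_has_derivative:
  "(flat_exp j has_real_derivative flat_exp (j + 2) t - real j * flat_exp (j + 1) t) (at t)"
proof -
  consider (pos) "t > 0" | (neg) "t < 0" | (zero) "t = 0" by linarith
  then show ?thesis
  proof cases
    case pos
    then have "((\<lambda>t. exp (- inverse t) / t ^ j) has_real_derivative
        (exp (- inverse t) * inverse (t\<^sup>2) * t ^ j - exp (- inverse t) * (real j * t ^ (j - 1)))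
          / (t ^ j * t ^ j)) (at t)"
      by (auto intro!: derivative_eq_intros simp: power2_eq_square)
    also have "(exp (- inverse t) * inverse (t\<^sup>2) * t ^ j - exp (- inverse t) * (real j * t ^ (j - 1)))
          / (t ^ j * t ^ j)
        = flat_exp (j + 2) t - real j * flat_exp (j + 1) t"
      using pos by (cases j) (simp_all add: flat_exp_def field_simps power2_eq_square)
    finally have "((\<lambda>t. exp (- inverse t) / t ^ j) has_real_derivative
        flat_exp (j + 2) t - real j * flat_exp (j + 1) t) (at t)" .
    then show ?thesis
      by (rule has_field_derivative_transform_within_open[where S = "{0<..}"])
        (use pos in \<open>auto simp: flat_exp_def\<close>)
  next
    case neg
    then have "((\<lambda>t. 0) has_real_derivative flat_exp (j + 2) t - real j * flat_exp (j + 1) t) (at t)"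
      by (simp add: flat_exp_def)
    then show ?thesis
      by (rule has_field_derivative_transform_within_open[where S = "{..<0}"])
        (use neg in \<open>auto simp: flat_exp_def\<close>)
  next
    case zero
    then show ?thesis
      using flat_exp_difference_quotient_tendsto_0[of j]
      by (simp add: has_field_derivative_iff flat_exp_def)
  qed
qed

lemma flat_exp_0_has_derivative: "(flat_exp 0 has_real_derivative flat_exp 2 t) (at t)"
  using flat_exp_has_derivative[of 0 t] by (simp add: numeral_2_eq_2)

lemma Ck_on_flat_exp: "Ck_on k S (flat_exp j)"
proof (induction k arbitrary: j)
  case 0
  have "isCont (flat_exp j) t" for t
    using flat_exp_has_derivative by (rule DERIV_isCont)
  then show ?case by (simp add: continuous_at_imp_continuous_on)
next
  case (Suc k)
  show ?case
    by (rule Ck_on_derivI[OF flat_exp_has_derivative])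
      (intro Ck_on_diff Ck_on_mult Ck_on_const Suc)
qed

subsection \<open>Gradients and compactly supported functions\<close>

definition grad :: "('a::euclidean_space \<Rightarrow> real) \<Rightarrow> 'a \<Rightarrow> 'a" where
  "grad f x = (\<Sum>b\<in>Basis. frechet_derivative f (at x) b *\<^sub>R b)"

definition Cck :: "nat \<Rightarrow> 'a::euclidean_space set \<Rightarrow> ('a \<Rightarrow> real) set" where
  "Cck k S = {f. Ck_on k UNIV f \<and> (\<exists>K. compact K \<and> K \<subseteq> S \<and> (\<forall>x. x \<notin> K \<longrightarrow> f x = 0))}"

lemma grad_inner_Basis: "b \<in> Basis \<Longrightarrow> grad f x \<bullet> b = frechet_derivative f (at x) b"
  by (simp add: grad_def inner_sum_left inner_Basis if_distrib[of "\<lambda>y. _ * y"] cong: if_cong)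

lemma grad_eqI: "GDERIV f x :> D \<Longrightarrow> grad f x = D"
  unfolding gderiv_def
  by (simp add: grad_def frechet_derivative_at[symmetric] inner_commute[of _ D] euclidean_representation)

lemma GDERIV_grad: "GDERIV f x :> D \<Longrightarrow> GDERIV f x :> grad f x"
  using grad_eqI by metis

lemma differentiable_imp_GDERIV_grad:
  assumes "f differentiable (at x)"
  shows "GDERIV f x :> grad f x"
proof -
  obtain f' where f': "(f has_derivative f') (at x)"
    using assms by (auto simp: differentiable_def)
  define D where "D = (\<Sum>b\<in>Basis. f' b *\<^sub>R b)"
  have "f' h = h \<bullet> D" for h
    using Linear_Algebra.linear_componentwise[OF has_derivative_linear[OF f'], of h 1]
    by (simp add: D_def inner_sum_right mult.commute)
  then have "f' = (\<lambda>h. h \<bullet> D)" by (rule ext)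
  with f' have "GDERIV f x :> D" by (simp add: gderiv_def)
  then show ?thesis by (rule GDERIV_grad)
qed

lemma Ck_on_1D:
  assumes "Ck_on 1 S f"
  shows "x \<in> S \<Longrightarrow> GDERIV f x :> grad f x" "continuous_on S (grad f)"
proof -
  obtain G where G: "\<And>x. x \<in> S \<Longrightarrow> GDERIV f x :> G x" "\<forall>b\<in>Basis. continuous_on S (\<lambda>x. G x \<bullet> b)"
    using assms by auto
  show "x \<in> S \<Longrightarrow> GDERIV f x :> grad f x" by (rule GDERIV_grad[OF G(1)])
  have "continuous_on S G" using G(2) by (simp add: continuous_on_componentwise[of S G])
  then show "continuous_on S (grad f)"
    by (rule continuous_on_eq) (simp add: grad_eqI[OF G(1)])
qed

lemma Ck_on_grad_inner:
  assumes "open S" "Ck_on (Suc k) S f" "b \<in> Basis"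
  shows "Ck_on k S (\<lambda>x. grad f x \<bullet> b)"
proof -
  obtain G where G: "\<And>x. x \<in> S \<Longrightarrow> GDERIV f x :> G x" "Ck_on k S (\<lambda>x. G x \<bullet> b)"
    using assms(2,3) by auto
  have "Ck_on k S (\<lambda>x. grad f x \<bullet> b) \<longleftrightarrow> Ck_on k S (\<lambda>x. G x \<bullet> b)"
    by (rule Ck_on_cong[OF assms(1)]) (simp add: grad_eqI[OF G(1)])
  with G(2) show ?thesis by simp
qed

lemma CckI:
  assumes "open S" "Ck_on k S f" "compact K" "K \<subseteq> S" "\<And>x. x \<notin> K \<Longrightarrow> f x = 0"
  shows "f \<in> Cck k S"
  using Ck_on_extend_by_zero[of S K k f] assms by (auto simp: Cck_def compact_imp_closed)

lemma Cck_Ck_on: "f \<in> Cck k S \<Longrightarrow> Ck_on k T f"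
  by (auto simp: Cck_def intro: Ck_on_subset)

lemma Cck_continuous_on: "f \<in> Cck k S \<Longrightarrow> continuous_on T f"
  by (blast intro: Cck_Ck_on Ck_on_imp_continuous_on)

lemma Cck_mono: "f \<in> Cck k S \<Longrightarrow> S \<subseteq> T \<Longrightarrow> f \<in> Cck k T"
  by (auto simp: Cck_def)

lemma Cck_mult:
  assumes "open S" "f \<in> Cck k S" "Ck_on k S g"
  shows "(\<lambda>x. f x * g x) \<in> Cck k S"
proof -
  obtain K where K: "compact K" "K \<subseteq> S" "\<And>x. x \<notin> K \<Longrightarrow> f x = 0"
    using assms(2) by (auto simp: Cck_def)
  show ?thesis
    by (rule CckI[OF assms(1) Ck_on_mult[OF Cck_Ck_on[OF assms(2)] assms(3)] K(1,2)]) (simp add: K(3))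
qed

lemma Cck_1D:
  assumes "f \<in> Cck 1 S"
  shows "GDERIV f x :> grad f x" "continuous_on T (grad f)"
  using Ck_on_1D[OF Cck_Ck_on[OF assms, of UNIV]] by (auto intro: continuous_on_subset)

lemma Cck_1E:
  assumes "f \<in> Cck 1 S"
  obtains K where "compact K" "K \<subseteq> S" "\<And>x. x \<notin> K \<Longrightarrow> f x = 0" "\<And>x. x \<notin> K \<Longrightarrow> grad f x = 0"
proof -
  obtain K where K: "compact K" "K \<subseteq> S" "\<And>x. x \<notin> K \<Longrightarrow> f x = 0"
    using assms by (auto simp: Cck_def)
  have "grad f x = 0" if "x \<notin> K" for x
  proof (rule grad_eqI)
    show "GDERIV f x :> 0"
      by (rule GDERIV_transform_within_open[OF GDERIV_const, of "- K"])
        (use K that in \<open>auto simp: compact_imp_closed\<close>)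
  qed
  with K that show ?thesis by blast
qed

lemma Cck_eq_0: "f \<in> Cck k S \<Longrightarrow> x \<notin> S \<Longrightarrow> f x = 0"
  by (auto simp: Cck_def)

lemma grad_Cck_eq_0:
  assumes "f \<in> Cck 1 S" "x \<notin> S"
  shows "grad f x = 0"
proof -
  obtain K where "K \<subseteq> S" "\<And>x. x \<notin> K \<Longrightarrow> grad f x = 0"
    using Cck_1E[OF assms(1)] by metis
  with assms(2) show ?thesis by blast
qed

lemma pderiv_i_eq_grad: "pderiv_i f i x = grad f x $ i"
  using grad_inner_Basis[of "axis i 1" f x]
  by (simp add: pderiv_i_def inner_axis)

lemma Ck_eq_Ck_on_UNIV: "Ck k f \<longleftrightarrow> Ck_on k UNIV f"
proof (induction k arbitrary: f)
  case (Suc k)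
  have Basis: "(\<forall>b\<in>Basis. P b) \<longleftrightarrow> (\<forall>i. P (axis i 1))" for P :: "real^'a \<Rightarrow> bool"
    by (auto simp: Basis_vec_def)
  show ?case
  proof
    assume f: "Ck (Suc k) f"
    then have "GDERIV f x :> grad f x" for x
      by (intro differentiable_imp_GDERIV_grad) (simp add: differentiable_on_def)
    moreover have "(\<lambda>x. grad f x $ i) = pderiv_i f i" for i
      by (simp add: pderiv_i_eq_grad fun_eq_iff)
    ultimately show "Ck_on (Suc k) UNIV f"
      unfolding Ck_on.simps Basis using f Suc by (intro exI[of _ "grad f"]) (simp add: inner_axis)
  next
    assume f: "Ck_on (Suc k) UNIV f"
    then obtain G where G: "\<And>x. GDERIV f x :> G x" "\<And>i. Ck_on k UNIV (\<lambda>x. G x $ i)"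
      unfolding Ck_on.simps Basis by (auto simp: inner_axis)
    have "pderiv_i f i = (\<lambda>x. G x $ i)" for i
      by (simp add: pderiv_i_eq_grad grad_eqI[OF G(1)] fun_eq_iff)
    moreover have "f differentiable (at x)" for x
      using G(1)[of x] unfolding gderiv_def by (rule differentiableI)
    ultimately show "Ck (Suc k) f"
      using Ck_on_imp_continuous_on[OF f] G(2) Suc by (simp add: differentiable_on_def)
  qed
qed simp

lemma test_funs_iff_Cck: "u \<in> test_funs U \<longleftrightarrow> (\<forall>k. u \<in> Cck k U)"
proof
  assume u: "u \<in> test_funs U"
  have "\<forall>x. x \<notin> closure {x. u x \<noteq> 0} \<longrightarrow> u x = 0"
    using closure_subset[of "{x. u x \<noteq> 0}"] by blast
  with u have "\<exists>K. compact K \<and> K \<subseteq> U \<and> (\<forall>x. x \<notin> K \<longrightarrow> u x = 0)"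
    unfolding test_funs_def by blast
  with u show "\<forall>k. u \<in> Cck k U"
    by (simp add: test_funs_def smooth_fun_def Ck_eq_Ck_on_UNIV Cck_def)
next
  assume u: "\<forall>k. u \<in> Cck k U"
  then obtain K where K: "compact K" "K \<subseteq> U" "\<And>x. x \<notin> K \<Longrightarrow> u x = 0"
    unfolding Cck_def by blast
  then have sub: "closure {x. u x \<noteq> 0} \<subseteq> K"
    by (intro closure_minimal) (auto intro: compact_imp_closed)
  have "compact (K \<inter> closure {x. u x \<noteq> 0})"
    by (rule compact_Int_closed[OF K(1) closed_closure])
  with sub have "compact (closure {x. u x \<noteq> 0})"
    by (simp add: Int_absorb1)
  with sub show "u \<in> test_funs U"
    using u K(2) by (auto simp: test_funs_def smooth_fun_def Ck_eq_Ck_on_UNIV Cck_def)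
qed

subsection \<open>The divergence theorem for compactly supported fields\<close>

lemma integrable_compact_support:
  fixes f :: "'a::euclidean_space \<Rightarrow> real"
  assumes "compact K" "continuous_on K f" "\<And>x. x \<notin> K \<Longrightarrow> f x = 0"
  shows "integrable lborel f"
proof -
  have "(\<lambda>x. indicator K x *\<^sub>R f x) = f"
    using assms(3) by (auto simp: indicator_def fun_eq_iff)
  then show ?thesis
    using borel_integrable_compact[OF assms(1,2)] by simp
qed

lemma integral_lborel_translation:
  fixes f :: "'a::euclidean_space \<Rightarrow> real"
  assumes "f \<in> borel_measurable borel"
  shows "(\<integral>x. f (a + x) \<partial>lborel) = integral\<^sup>L lborel f"
  using integral_distr[of "(+) a" lborel borel f] assms by (simp add: lborel_distr_plus)

lemma integrable_lborel_translation:
  fixes f :: "'a::euclidean_space \<Rightarrow> real"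
  assumes "integrable lborel f"
  shows "integrable lborel (\<lambda>x. f (a + x))"
  using integrable_distr[of "(+) a" lborel borel f] assms by (simp add: lborel_distr_plus)

lemma has_vector_derivative_along_line:
  assumes "(f has_derivative f') (at (t *\<^sub>R v + x))"
  shows "((\<lambda>t. f (t *\<^sub>R v + x)) has_vector_derivative f' v) (at t within S)"
proof -
  have "((\<lambda>t. t *\<^sub>R v + x) has_derivative (\<lambda>s. s *\<^sub>R v)) (at t)"
    by (auto intro!: derivative_eq_intros)
  from has_derivative_compose[OF this assms]
  have "((\<lambda>t. f (t *\<^sub>R v + x)) has_vector_derivative f' v) (at t)"
    unfolding has_vector_derivative_def linear_scale[OF has_derivative_linear[OF assms]] .
  then show ?thesis by (rule has_vector_derivative_at_within)
qed

lemma integral_grad_along_segment: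
  fixes f :: "'a::euclidean_space \<Rightarrow> real"
  assumes "\<And>x. GDERIV f x :> grad f x" "continuous_on UNIV (grad f)"
  shows "(\<integral>t. indicator {0..1} t *\<^sub>R (grad f (t *\<^sub>R v + x) \<bullet> v) \<partial>lborel) = f (v + x) - f x"
proof -
  have "((\<lambda>t. f (t *\<^sub>R v + x)) has_vector_derivative grad f (t *\<^sub>R v + x) \<bullet> v) (at t within {0..1})" for t
    using has_vector_derivative_along_line[OF assms(1)[of "t *\<^sub>R v + x", unfolded gderiv_def]]
    by (simp add: inner_commute)
  moreover have "continuous_on {0..1} (\<lambda>t. grad f (t *\<^sub>R v + x) \<bullet> v)"
    by (intro continuous_intros continuous_on_compose2[OF assms(2)]) auto
  ultimately show ?thesis
    using integral_FTC_atLeastAtMost[of 0 1 "\<lambda>t. f (t *\<^sub>R v + x)" "\<lambda>t. grad f (t *\<^sub>R v + x) \<bullet> v"]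
    by simp
qed

lemma integrable_along_segments:
  fixes g :: "'a::euclidean_space \<Rightarrow> real"
  assumes "compact K" "continuous_on UNIV g" "\<And>x. x \<notin> K \<Longrightarrow> g x = 0"
  shows "integrable (lborel \<Otimes>\<^sub>M lborel) (\<lambda>(t, x). indicator {0..1} t *\<^sub>R g (t *\<^sub>R v + x))"
  unfolding lborel_prod
proof (rule integrable_compact_support)
  let ?C = "(\<lambda>(t, y). (t, y - t *\<^sub>R v)) ` ({0..1::real} \<times> K)"
  show "compact ?C"
    using assms(1) by (intro compact_continuous_image compact_Times)
      (auto simp: case_prod_unfold intro!: continuous_intros)
  have "continuous_on UNIV (\<lambda>(t, x). g (t *\<^sub>R v + x))"
    unfolding case_prod_unfold
    by (rule continuous_on_compose2[OF assms(2)]) (auto intro!: continuous_intros)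
  then show "continuous_on ?C (\<lambda>(t, x). indicator {0..1} t *\<^sub>R g (t *\<^sub>R v + x))"
    by (rule continuous_on_eq[OF continuous_on_subset]) auto
  show "(\<lambda>(t, x). indicator {0..1} t *\<^sub>R g (t *\<^sub>R v + x)) z = 0" if "z \<notin> ?C" for z
    using that assms(3)[of "fst z *\<^sub>R v + snd z"]
    by (cases z) (force simp: indicator_def image_iff)
qed

text \<open>Integrate \<open>f (v + x) - f x\<close>, the integral of the derivative along the segment,
  over \<open>x\<close>, and exchange the two integrals.\<close>

lemma has_bochner_integral_grad_inner:
  assumes f: "f \<in> Cck 1 UNIV"
  shows "has_bochner_integral lborel (\<lambda>x. grad f x \<bullet> v) 0"
proof -
  obtain K where K: "compact K" "\<And>x. x \<notin> K \<Longrightarrow> f x = 0" "\<And>x. x \<notin> K \<Longrightarrow> grad f x = 0"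
    using Cck_1E[OF f] by metis
  have f_cont: "continuous_on UNIV f" and grad_cont: "continuous_on UNIV (\<lambda>x. grad f x \<bullet> v)"
    by (intro continuous_intros Cck_continuous_on[OF f] Cck_1D(2)[OF f])+
  have int_f: "integrable lborel f" and int_grad: "integrable lborel (\<lambda>x. grad f x \<bullet> v)"
    using K(2,3) continuous_on_subset[OF f_cont] continuous_on_subset[OF grad_cont]
    by (intro integrable_compact_support[OF K(1)]; simp)+
  define F where "F t x = indicator {0..1} t *\<^sub>R (grad f (t *\<^sub>R v + x) \<bullet> v)" for t :: real and x
  have slice: "(\<integral>x. F t x \<partial>lborel) = indicator {0..1} t * (\<integral>x. grad f x \<bullet> v \<partial>lborel)" for t
    unfolding F_def using integral_lborel_translation[of "\<lambda>x. grad f x \<bullet> v" "t *\<^sub>R v"] grad_cont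
    by (simp add: borel_measurable_continuous_onI)
  have segment: "(\<integral>t. F t x \<partial>lborel) = f (v + x) - f x" for x
    unfolding F_def by (rule integral_grad_along_segment[OF Cck_1D[OF f]])
  have "integrable (lborel \<Otimes>\<^sub>M lborel) (\<lambda>(t, x). F t x)"
    unfolding F_def by (rule integrable_along_segments[OF K(1) grad_cont]) (simp add: K(3))
  then have "(\<integral>x. (\<integral>t. F t x \<partial>lborel) \<partial>lborel) = (\<integral>t. (\<integral>x. F t x \<partial>lborel) \<partial>lborel)"
    by (rule lborel_pair.Fubini_integral)
  then have "(\<integral>x. grad f x \<bullet> v \<partial>lborel) = (\<integral>x. f (v + x) - f x \<partial>lborel)"
    by (simp add: segment slice)
  also have "\<dots> = 0"
    using integrable_lborel_translation[OF int_f] int_f f_cont integral_lborel_translation[of f v]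
    by (simp add: borel_measurable_continuous_onI)
  finally show ?thesis
    using int_grad by (simp add: has_bochner_integral_iff)
qed

definition divergence :: "('a::euclidean_space \<Rightarrow> 'a) \<Rightarrow> 'a \<Rightarrow> real" where
  "divergence X x = (\<Sum>b\<in>Basis. grad (\<lambda>y. X y \<bullet> b) x \<bullet> b)"

lemma divergence_eqI:
  assumes "(X has_derivative X') (at x)"
  shows "divergence X x = (\<Sum>b\<in>Basis. X' b \<bullet> b)"
  unfolding divergence_def
proof (rule sum.cong[OF refl])
  fix b :: 'a assume b: "b \<in> Basis"
  have "((\<lambda>y. X y \<bullet> b) has_derivative (\<lambda>v. X' v \<bullet> b)) (at x)"
    by (rule has_derivative_inner_left[OF assms])
  then have "frechet_derivative (\<lambda>y. X y \<bullet> b) (at x) = (\<lambda>v. X' v \<bullet> b)"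
    by (rule frechet_derivative_at[symmetric])
  then show "grad (\<lambda>y. X y \<bullet> b) x \<bullet> b = X' b \<bullet> b"
    using b by (simp add: grad_inner_Basis)
qed

lemma divergence_scaleR:
  fixes X :: "'a::euclidean_space \<Rightarrow> 'a"
  assumes f: "GDERIV f x :> D" and X: "(X has_derivative X') (at x)"
  shows "divergence (\<lambda>y. f y *\<^sub>R X y) x = f x * divergence X x + D \<bullet> X x"
proof -
  have "((\<lambda>y. f y *\<^sub>R X y) has_derivative (\<lambda>v. f x *\<^sub>R X' v + (v \<bullet> D) *\<^sub>R X x)) (at x)"
    by (rule has_derivative_scaleR[OF f[unfolded gderiv_def] X])
  then have "divergence (\<lambda>y. f y *\<^sub>R X y) x = (\<Sum>b\<in>Basis. f x * (X' b \<bullet> b) + (D \<bullet> b) * (X x \<bullet> b))"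
    by (simp add: divergence_eqI inner_add_left inner_commute[of _ D])
  then show ?thesis
    by (simp add: divergence_eqI[OF X] sum.distrib sum_distrib_left euclidean_inner[of D "X x"])
qed

lemma divergence_transform_within_open:
  assumes X: "(X has_derivative X') (at x)" and S: "open S" "x \<in> S" "\<And>y. y \<in> S \<Longrightarrow> X y = Y y"
  shows "divergence X x = divergence Y x"
  using divergence_eqI[OF X] divergence_eqI[OF has_derivative_transform_within_open[OF X S]] by simp

lemma has_bochner_integral_divergence_scaleR:
  assumes S: "open S" and w: "w \<in> Cck 1 S" and X: "\<And>b. b \<in> Basis \<Longrightarrow> Ck_on 1 S (\<lambda>x. X x \<bullet> b)"
  shows "has_bochner_integral lborel (\<lambda>x. grad w x \<bullet> X x + w x * divergence X x) 0"
proof -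
  have wX: "(\<lambda>x. w x * (X x \<bullet> b)) \<in> Cck 1 S" if "b \<in> Basis" for b
    by (rule Cck_mult[OF S w X[OF that]])
  have "grad (\<lambda>x. w x * (X x \<bullet> b)) x = w x *\<^sub>R grad (\<lambda>x. X x \<bullet> b) x + (X x \<bullet> b) *\<^sub>R grad w x"
    if b: "b \<in> Basis" for b x
  proof (cases "x \<in> S")
    case True
    then show ?thesis
      by (intro grad_eqI GDERIV_mult Cck_1D(1)[OF w] Ck_on_1D(1)[OF X[OF b]])
  next
    case False
    then show ?thesis
      by (simp add: Cck_eq_0[OF w] grad_Cck_eq_0[OF w] grad_Cck_eq_0[OF wX[OF b]])
  qed
  then have "(\<Sum>b\<in>Basis. grad (\<lambda>x. w x * (X x \<bullet> b)) x \<bullet> b) = grad w x \<bullet> X x + w x * divergence X x" for x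
    by (simp add: divergence_def inner_add_left sum.distrib sum_distrib_left
        euclidean_inner[of "grad w x" "X x"] mult.commute)
  moreover have "has_bochner_integral lborel
      (\<lambda>x. \<Sum>b\<in>Basis. grad (\<lambda>x. w x * (X x \<bullet> b)) x \<bullet> b) (\<Sum>b\<in>(Basis::'a set). 0)"
    by (intro has_bochner_integral_sum has_bochner_integral_grad_inner[OF Cck_mono[OF wX subset_UNIV]])
  ultimately show ?thesis by simp
qed

subsection \<open>Integration and gradients in the Poincare ball\<close>

definition defect :: "real^'n \<Rightarrow> real" where
  "defect x = 1 - (norm x)\<^sup>2"

definition hintegrable :: "(real^'n \<Rightarrow> real) \<Rightarrow> bool" where
  "hintegrable f \<longleftrightarrow> integrable lborel (\<lambda>x. f x * hdens x)"

definition hgrad_inner :: "(real^'n \<Rightarrow> real) \<Rightarrow> (real^'n \<Rightarrow> real) \<Rightarrow> real^'n \<Rightarrow> real" where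
  "hgrad_inner u v x = (defect x / 2)\<^sup>2 * (grad u x \<bullet> grad v x)"

definition hlaplace :: "(real^'n \<Rightarrow> real) \<Rightarrow> real^'n \<Rightarrow> real" where
  "hlaplace u x = divergence (\<lambda>y. (hdens y * (defect y / 2)\<^sup>2) *\<^sub>R grad u y) x / hdens x"

lemma open_hball: "open (hball :: (real^'n) set)"
  by (simp add: hball_def)

lemma defect_pos: "x \<in> hball \<Longrightarrow> 0 < defect x"
  by (simp add: hball_def defect_def abs_square_less_1)

lemma GDERIV_defect: "GDERIV defect x :> - 2 *\<^sub>R x"
  unfolding defect_def[abs_def]
  using GDERIV_diff[OF GDERIV_const GDERIV_norm_diff_sq[of 0], of 1] by simp

lemma Ck_on_defect: "Ck_on k S defect"
  unfolding defect_def[abs_def]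
  using Ck_on_diff[OF Ck_on_const Ck_on_norm_diff_sq[of k S 0], of 1] by simp

lemma Ck_on_inverse_defect: "Ck_on k hball (\<lambda>x. inverse (defect x))"
  by (rule Ck_on_compose[OF _ Ck_on_inverse Ck_on_defect]) (simp add: defect_pos)

lemma hdens_eq: "hdens x = (2 * inverse (defect x)) ^ CARD('n)" for x :: "real^'n"
  by (simp add: hdens_def defect_def divide_inverse)

lemma hdens_pos: "x \<in> hball \<Longrightarrow> 0 < hdens x"
  using defect_pos[of x] by (simp add: hdens_eq)

lemma Ck_on_hdens: "Ck_on k hball (hdens :: real^'n \<Rightarrow> real)"
  unfolding hdens_eq[abs_def] by (intro Ck_on_power Ck_on_mult Ck_on_const Ck_on_inverse_defect)

lemma continuous_on_hdens: "S \<subseteq> hball \<Longrightarrow> continuous_on S hdens"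
  using Ck_on_imp_continuous_on[OF Ck_on_hdens] by (rule continuous_on_subset)

lemma borel_measurable_hdens: "hdens \<in> borel_measurable borel"
  unfolding hdens_def[abs_def] by measurable

lemma GDERIV_hdens:
  fixes x :: "real^'n"
  assumes "x \<in> hball"
  shows "GDERIV hdens x :> (2 * real CARD('n) / defect x * hdens x) *\<^sub>R x"
proof -
  obtain m where m: "CARD('n) = Suc m" by (cases "CARD('n)") auto
  have "((\<lambda>t. 2 * inverse t) has_real_derivative - 2 * (inverse (defect x))\<^sup>2) (at (defect x))"
    using defect_pos[OF assms] by (auto intro!: derivative_eq_intros simp: power2_eq_square)
  from DERIV_power[OF this, of "CARD('n)"]
  have "((\<lambda>t. (2 * inverse t) ^ CARD('n)) has_real_derivative
      real CARD('n) * (- 2 * (inverse (defect x))\<^sup>2) * (2 * inverse (defect x)) ^ m) (at (defect x))"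
    by (simp add: m mult.assoc)
  from GDERIV_DERIV_compose[OF GDERIV_defect this] show ?thesis
    using defect_pos[OF assms] unfolding hdens_eq[abs_def] m
    by (simp add: divide_inverse power2_eq_square mult_ac)
qed

lemma hgrad_sq_eq: "hgrad_sq u x = hgrad_inner u u x"
  by (simp add: hgrad_sq_def hgrad_inner_def defect_def pderiv_i_eq_grad inner_vec_def power2_eq_square)

lemma hgrad_inner_mult_left:
  assumes "GDERIV f x :> D" "GDERIV g x :> E"
  shows "hgrad_inner (\<lambda>x. f x * g x) v x = f x * hgrad_inner g v x + g x * hgrad_inner f v x"
  by (simp add: hgrad_inner_def inner_add_left algebra_simps
      grad_eqI[OF GDERIV_mult[OF assms]] grad_eqI[OF assms(1)] grad_eqI[OF assms(2)])

lemma hgrad_inner_power2_left: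
  "GDERIV u x :> D \<Longrightarrow> hgrad_inner (\<lambda>x. (u x)\<^sup>2) v x = 2 * u x * hgrad_inner u v x"
  by (simp add: power2_eq_square hgrad_inner_mult_left)

lemma hgrad_sq_nonneg: "0 \<le> hgrad_sq u x"
  by (simp add: hgrad_sq_eq hgrad_inner_def)

lemma hintegrable_compact_support:
  assumes "compact K" "K \<subseteq> hball" "continuous_on K f" "\<And>x. x \<notin> K \<Longrightarrow> f x = 0"
  shows "hintegrable f"
  unfolding hintegrable_def
  by (rule integrable_compact_support[OF assms(1)])
    (intro continuous_on_mult assms(3) continuous_on_hdens[OF assms(2)], simp add: assms(4))

lemma hintegrable_Cck_mult:
  assumes w: "w \<in> Cck k S" and "S \<subseteq> hball" "continuous_on S p"
  shows "hintegrable (\<lambda>x. p x * w x)"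
proof -
  obtain K where K: "compact K" "K \<subseteq> S" "\<And>x. x \<notin> K \<Longrightarrow> w x = 0"
    using w by (auto simp: Cck_def)
  show ?thesis
  proof (rule hintegrable_compact_support[OF K(1)])
    show "continuous_on K (\<lambda>x. p x * w x)"
      using continuous_on_subset[OF assms(3) K(2)] Cck_continuous_on[OF w]
      by (rule continuous_on_mult)
  qed (use K assms(2) in auto)
qed

lemma hintegrable_hgrad_sq:
  assumes "u \<in> Cck 1 hball"
  shows "hintegrable (hgrad_sq u)"
proof -
  obtain K where K: "compact K" "K \<subseteq> hball" "\<And>x. x \<notin> K \<Longrightarrow> grad u x = 0"
    using Cck_1E[OF assms] by metis
  show ?thesis
  proof (rule hintegrable_compact_support[OF K(1,2)])
    show "continuous_on K (hgrad_sq u)"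
      unfolding hgrad_sq_eq[abs_def] hgrad_inner_def
      by (intro continuous_intros Cck_1D(2)[OF assms] Ck_on_imp_continuous_on[OF Ck_on_defect]) simp
  qed (simp add: hgrad_sq_eq hgrad_inner_def K(3))
qed

lemma hintegrable_add: "hintegrable f \<Longrightarrow> hintegrable g \<Longrightarrow> hintegrable (\<lambda>x. f x + g x)"
  by (simp add: hintegrable_def distrib_right)

lemma hint_add: "hintegrable f \<Longrightarrow> hintegrable g \<Longrightarrow> hint (\<lambda>x. f x + g x) = hint f + hint g"
  by (simp add: hintegrable_def hint_def distrib_right)

lemma hintegrable_diff: "hintegrable f \<Longrightarrow> hintegrable g \<Longrightarrow> hintegrable (\<lambda>x. f x - g x)"
  by (simp add: hintegrable_def left_diff_distrib)

lemma hint_diff: "hintegrable f \<Longrightarrow> hintegrable g \<Longrightarrow> hint (\<lambda>x. f x - g x) = hint f - hint g"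
  by (simp add: hintegrable_def hint_def left_diff_distrib)

lemma hintegrable_cmult: "hintegrable f \<Longrightarrow> hintegrable (\<lambda>x. c * f x)"
  by (simp add: hintegrable_def mult.assoc)

lemma hint_cmult: "hint (\<lambda>x. c * f x) = c * hint f"
  by (simp add: hint_def mult.assoc)

text \<open>Outside the ball \<open>hdens\<close> need not be nonnegative, so the integrands have to agree there.\<close>

lemma hint_mono:
  assumes "hintegrable f" "hintegrable g" "\<And>x. x \<in> hball \<Longrightarrow> f x \<le> g x"
    and "\<And>x. x \<notin> hball \<Longrightarrow> f x = g x"
  shows "hint f \<le> hint g"
  unfolding hint_def
proof (rule integral_mono)
  show "f x * hdens x \<le> g x * hdens x" for x
    using assms(3,4) hdens_pos[of x] by (cases "x \<in> hball") (auto intro: mult_right_mono less_imp_le)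
qed (use assms(1,2) in \<open>simp_all add: hintegrable_def\<close>)

lemma hint_nonneg:
  assumes "\<And>x. 0 \<le> f x" "\<And>x. x \<notin> hball \<Longrightarrow> f x = 0"
  shows "0 \<le> hint f"
  unfolding hint_def
proof (rule integral_nonneg_AE[OF AE_I2])
  show "0 \<le> f x * hdens x" for x
    using assms[of x] hdens_pos[of x] by (cases "x \<in> hball") auto
qed

lemma hintegrable_bound:
  assumes "hintegrable f" "g \<in> borel_measurable borel" "\<And>x. \<bar>g x\<bar> \<le> \<bar>f x\<bar>"
  shows "hintegrable g"
  unfolding hintegrable_def
proof (rule Bochner_Integration.integrable_bound)
  show "integrable lborel (\<lambda>x. f x * hdens x)"
    using assms(1) by (simp add: hintegrable_def)
  show "(\<lambda>x. g x * hdens x) \<in> borel_measurable lborel"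
    by (simp add: borel_measurable_times assms(2) borel_measurable_hdens)
  show "AE x in lborel. norm (g x * hdens x) \<le> norm (f x * hdens x)"
    using assms(3) by (simp add: abs_mult mult_right_mono)
qed

lemma hint_green:
  assumes S: "open S" "S \<subseteq> hball" and w: "w \<in> Cck 1 S" and v: "Ck_on 2 S v"
  shows "hintegrable (\<lambda>x. hgrad_inner w v x + w x * hlaplace v x)"
    "hint (\<lambda>x. hgrad_inner w v x + w x * hlaplace v x) = 0"
proof -
  define X where "X x = (hdens x * (defect x / 2)\<^sup>2) *\<^sub>R grad v x" for x
  have "Ck_on 1 S (\<lambda>x. X x \<bullet> b)" if "b \<in> Basis" for b
  proof -
    have "Ck_on 1 S (\<lambda>x. grad v x \<bullet> b)"
      using Ck_on_grad_inner[OF S(1) _ that, of 1 v] v by (simp only: Suc_1)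
    then show ?thesis
      unfolding X_def inner_scaleR_left divide_inverse
      by (intro Ck_on_mult Ck_on_power Ck_on_const Ck_on_defect Ck_on_subset[OF Ck_on_hdens S(2)])
  qed
  note div = has_bochner_integral_divergence_scaleR[OF S(1) w this]
  have "grad w x \<bullet> X x + w x * divergence X x = (hgrad_inner w v x + w x * hlaplace v x) * hdens x" for x
  proof (cases "x \<in> S")
    case True
    then show ?thesis
      using hdens_pos[of x] S(2)
      by (auto simp: X_def[abs_def] hgrad_inner_def hlaplace_def field_simps)
  next
    case False
    then show ?thesis
      by (simp add: Cck_eq_0[OF w] grad_Cck_eq_0[OF w] hgrad_inner_def)
  qed
  then show "hintegrable (\<lambda>x. hgrad_inner w v x + w x * hlaplace v x)"
    "hint (\<lambda>x. hgrad_inner w v x + w x * hlaplace v x) = 0"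
    using div by (simp_all add: hintegrable_def hint_def has_bochner_integral_iff)
qed

subsection \<open>The distance from a pole\<close>

locale hyperbolic_pole =
  fixes x0 :: "real^'n"
  assumes pole_in_hball: "x0 \<in> hball"
begin

definition \<Omega> :: "(real^'n) set" where
  "\<Omega> = hball - {x0}"

definition r :: "real^'n \<Rightarrow> real" where
  "r x = hdist x x0"

definition cosh_dist :: "real^'n \<Rightarrow> real" where
  "cosh_dist x = 1 + 2 * (norm (x - x0))\<^sup>2 / (defect x * defect x0)"

lemma open_Omega: "open \<Omega>"
  by (simp add: \<Omega>_def open_hball open_delete)

lemma Omega_subset: "\<Omega> \<subseteq> hball"
  by (auto simp: \<Omega>_def)

lemma defect_pole_pos: "0 < defect x0"
  using defect_pos pole_in_hball by blast

lemma cosh_dist_ge_1: "x \<in> hball \<Longrightarrow> 1 \<le> cosh_dist x"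
  using defect_pos[of x] defect_pole_pos by (simp add: cosh_dist_def)

lemma cosh_dist_gt_1: "x \<in> \<Omega> \<Longrightarrow> 1 < cosh_dist x"
  using defect_pos[of x] defect_pole_pos by (simp add: cosh_dist_def \<Omega>_def)

lemma r_eq_arcosh: "r x = arcosh (cosh_dist x)"
  by (simp add: r_def hdist_def cosh_dist_def defect_def)

lemma cosh_r: "x \<in> hball \<Longrightarrow> cosh (r x) = cosh_dist x"
  using cosh_dist_ge_1 by (simp add: r_eq_arcosh)

lemma r_nonneg: "x \<in> hball \<Longrightarrow> 0 \<le> r x"
  using cosh_dist_ge_1 by (simp add: r_eq_arcosh)

lemma r_pos: "x \<in> \<Omega> \<Longrightarrow> 0 < r x"
  using cosh_dist_gt_1[of x] by (simp add: r_eq_arcosh)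

lemma sinh_r_pos: "x \<in> \<Omega> \<Longrightarrow> 0 < sinh (r x)"
  using r_pos by simp

lemma r_pole: "r x0 = 0"
  by (simp add: r_eq_arcosh cosh_dist_def)

lemma borel_measurable_r: "r \<in> borel_measurable borel"
  unfolding r_def[abs_def] hdist_def arcosh_def by measurable

lemma cosh_dist_eq: "cosh_dist = (\<lambda>x. 1 + 2 / defect x0 * ((norm (x - x0))\<^sup>2 * inverse (defect x)))"
  by (auto simp: cosh_dist_def divide_inverse)

lemma Ck_on_cosh_dist: "Ck_on k hball cosh_dist"
  unfolding cosh_dist_eq
  by (intro Ck_on_add Ck_on_mult Ck_on_const Ck_on_inverse_defect Ck_on_norm_diff_sq)

lemma Ck_on_r: "Ck_on k \<Omega> r"
  unfolding r_eq_arcosh[abs_def]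
  by (rule Ck_on_compose[OF _ Ck_on_arcosh Ck_on_subset[OF Ck_on_cosh_dist Omega_subset]])
    (simp add: cosh_dist_gt_1)

lemma continuous_on_r: "continuous_on hball r"
  unfolding r_eq_arcosh[abs_def]
  by (rule continuous_on_compose2[OF continuous_on_arcosh[OF order.refl]
        Ck_on_imp_continuous_on[OF Ck_on_cosh_dist[of 0]]]) (use cosh_dist_ge_1 in auto)

lemma continuous_on_radial: "continuous_on {0<..} f \<Longrightarrow> continuous_on \<Omega> (\<lambda>x. f (r x))"
  by (rule continuous_on_compose2[OF _ continuous_on_subset[OF continuous_on_r Omega_subset]])
    (auto simp: r_pos)

lemma GDERIV_r: "x \<in> \<Omega> \<Longrightarrow> GDERIV r x :> grad r x"
  by (rule Ck_on_1D(1)[OF Ck_on_r])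

lemma compact_ge_r:
  assumes "compact L" "L \<subseteq> hball" "0 < a"
  shows "compact {x\<in>L. a \<le> r x}" "{x\<in>L. a \<le> r x} \<subseteq> \<Omega>"
proof -
  have "closed {x\<in>L. a \<le> r x}"
    using assms(1,2)
    by (intro continuous_on_closed_Collect_le continuous_on_const continuous_on_subset[OF continuous_on_r])
      (auto intro: compact_imp_closed)
  then have "compact (L \<inter> {x\<in>L. a \<le> r x})"
    by (rule compact_Int_closed[OF assms(1)])
  moreover have "L \<inter> {x\<in>L. a \<le> r x} = {x\<in>L. a \<le> r x}" by blast
  ultimately show "compact {x\<in>L. a \<le> r x}" by simp
  show "{x\<in>L. a \<le> r x} \<subseteq> \<Omega>" using assms r_pole by (auto simp: \<Omega>_def)
qed

lemma r_le_iff: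
  assumes "x \<in> hball" "0 \<le> b"
  shows "r x \<le> b \<longleftrightarrow> 2 * (norm (x - x0))\<^sup>2 \<le> (cosh b - 1) * (defect x * defect x0)"
proof -
  have "r x \<le> b \<longleftrightarrow> cosh_dist x \<le> cosh b"
    using cosh_real_nonneg_le_iff[OF r_nonneg[OF assms(1)] assms(2)] cosh_r[OF assms(1)] by simp
  then show ?thesis
    using defect_pos[OF assms(1)] defect_pole_pos by (simp add: cosh_dist_def field_simps)
qed

lemma compact_r_le:
  assumes "0 \<le> b"
  shows "compact {x\<in>hball. r x \<le> b}"
proof -
  have "x \<in> hball" if "norm x \<le> 1" "2 * (norm (x - x0))\<^sup>2 \<le> (cosh b - 1) * (defect x * defect x0)" for x
  proof (rule ccontr)
    assume "x \<notin> hball"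
    then have "norm x = 1" using that(1) by (simp add: hball_def)
    moreover from this have "x = x0" using that(2) by (simp add: defect_def)
    ultimately show False using pole_in_hball by (simp add: hball_def)
  qed
  then have "{x\<in>hball. r x \<le> b}
      = cball 0 1 \<inter> {x. 2 * (norm (x - x0))\<^sup>2 \<le> (cosh b - 1) * (defect x * defect x0)}"
    using r_le_iff[OF _ assms] by (auto simp: hball_def)
  moreover have "closed {x. 2 * (norm (x - x0))\<^sup>2 \<le> (cosh b - 1) * (defect x * defect x0)}"
    unfolding defect_def by (intro closed_Collect_le continuous_intros)
  ultimately show ?thesis by (simp add: compact_Int_closed)
qed

abbreviation annulus :: "real \<Rightarrow> real \<Rightarrow> (real^'n) set" where
  "annulus a b \<equiv> {x\<in>hball. r x \<in> {a..b}}"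

lemma compact_annulus:
  assumes "0 < a"
  shows "compact (annulus a b)" "annulus a b \<subseteq> \<Omega>"
proof -
  have "annulus a b = {x\<in>{x\<in>hball. r x \<le> max 0 b}. a \<le> r x}"
    using assms by auto
  then show "compact (annulus a b)" "annulus a b \<subseteq> \<Omega>"
    using compact_ge_r[OF compact_r_le[of "max 0 b"] _ assms] by auto
qed

definition pole_field :: "real^'n \<Rightarrow> real^'n" where
  "pole_field x = defect x *\<^sub>R (x - x0) + (norm (x - x0))\<^sup>2 *\<^sub>R x"

lemma grad_cosh_dist:
  assumes "x \<in> hball"
  shows "grad cosh_dist x = (4 / (defect x0 * (defect x)\<^sup>2)) *\<^sub>R pole_field x"
proof -
  have "GDERIV cosh_dist x :>
      0 + ((2 / defect x0) *\<^sub>R ((norm (x - x0))\<^sup>2 *\<^sub>R (- (inverse (defect x))\<^sup>2 *\<^sub>R (- 2 *\<^sub>R x))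
        + inverse (defect x) *\<^sub>R (2 *\<^sub>R (x - x0)))
      + ((norm (x - x0))\<^sup>2 * inverse (defect x)) *\<^sub>R 0)"
    unfolding cosh_dist_eq using defect_pos[OF assms]
    by (intro GDERIV_add GDERIV_mult GDERIV_const GDERIV_inverse GDERIV_defect GDERIV_norm_diff_sq) auto
  then have "grad cosh_dist x = (2 / defect x0) *\<^sub>R ((2 * (norm (x - x0))\<^sup>2 * (inverse (defect x))\<^sup>2) *\<^sub>R x
      + (2 * inverse (defect x)) *\<^sub>R (x - x0))"
    by (simp add: grad_eqI mult_ac)
  also have "\<dots> = (4 / (defect x0 * (defect x)\<^sup>2)) *\<^sub>R pole_field x"
    using defect_pos[OF assms] unfolding pole_field_def scaleR_add_right scaleR_scaleR
    by (simp add: power2_eq_square add.commute field_simps)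
  finally show ?thesis .
qed

lemma two_inner_pole_diff: "2 * (x \<bullet> (x - x0)) = defect x0 - defect x + (norm (x - x0))\<^sup>2"
  by (simp add: defect_def power2_norm_eq_inner inner_diff inner_commute algebra_simps)

lemma inner_self_eq_defect: "x \<bullet> x = 1 - defect x"
  by (simp add: defect_def power2_norm_eq_inner)

lemma inner_pole_field_self:
  "pole_field x \<bullet> pole_field x = (norm (x - x0))\<^sup>2 * (defect x * defect x0 + (norm (x - x0))\<^sup>2)"
proof -
  define e where "e = (norm (x - x0))\<^sup>2"
  have "pole_field x \<bullet> pole_field x
      = (defect x)\<^sup>2 * ((x - x0) \<bullet> (x - x0)) + defect x * e * (2 * (x \<bullet> (x - x0))) + e\<^sup>2 * (x \<bullet> x)"
    unfolding pole_field_def e_def[symmetric] inner_add_left inner_add_right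
      inner_scaleR_left inner_scaleR_right
    by (simp add: inner_diff inner_commute[of x0 x] power2_eq_square algebra_simps)
  also have "\<dots> = (defect x)\<^sup>2 * e + defect x * e * (defect x0 - defect x + e) + e\<^sup>2 * (1 - defect x)"
    unfolding two_inner_pole_diff inner_self_eq_defect e_def power2_norm_eq_inner ..
  finally show ?thesis
    unfolding e_def[symmetric] by (simp add: power2_eq_square algebra_simps)
qed

lemma hgrad_inner_cosh_dist:
  assumes "x \<in> hball"
  shows "hgrad_inner cosh_dist cosh_dist x = (cosh_dist x)\<^sup>2 - 1"
  using defect_pos[OF assms] defect_pole_pos
  by (simp add: hgrad_inner_def grad_cosh_dist[OF assms] inner_pole_field_self cosh_dist_def
      power2_eq_square field_simps)

lemma grad_cosh_dist_eq_grad_r: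
  assumes "x \<in> \<Omega>"
  shows "grad cosh_dist x = sinh (r x) *\<^sub>R grad r x"
proof (rule grad_eqI, rule GDERIV_transform_within_open)
  show "GDERIV (\<lambda>x. cosh (r x)) x :> sinh (r x) *\<^sub>R grad r x"
    by (rule GDERIV_DERIV_compose[OF GDERIV_r[OF assms]]) (auto intro!: derivative_eq_intros)
  show "cosh (r y) = cosh_dist y" if "y \<in> \<Omega>" for y
    using that Omega_subset cosh_r by blast
qed (use assms open_Omega in auto)

lemma eikonal:
  assumes "x \<in> \<Omega>"
  shows "hgrad_inner r r x = 1"
proof -
  have x: "x \<in> hball" using assms Omega_subset by blast
  have "(sinh (r x))\<^sup>2 * hgrad_inner r r x = hgrad_inner cosh_dist cosh_dist x"
    by (simp add: hgrad_inner_def grad_cosh_dist_eq_grad_r[OF assms] power2_eq_square)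
  also have "\<dots> = (sinh (r x))\<^sup>2"
    by (simp add: hgrad_inner_cosh_dist[OF x] cosh_r[OF x, symmetric] cosh_square_eq)
  finally show ?thesis using sinh_r_pos[OF assms] by simp
qed

lemma pole_field_has_derivative:
  "(pole_field has_derivative (\<lambda>v. (defect x + (norm (x - x0))\<^sup>2) *\<^sub>R v
    - (2 * (v \<bullet> x)) *\<^sub>R (x - x0) + (2 * (v \<bullet> (x - x0))) *\<^sub>R x)) (at x)"
  unfolding pole_field_def[abs_def]
proof (rule has_derivative_eq_rhs[OF has_derivative_add[OF
      has_derivative_scaleR[OF GDERIV_defect[unfolded gderiv_def]]
      has_derivative_scaleR[OF GDERIV_norm_diff_sq[unfolded gderiv_def] has_derivative_ident]]])
  show "((\<lambda>x. x - x0) has_derivative (\<lambda>v. v)) (at x)"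
    by (auto intro!: derivative_eq_intros)
qed (simp add: fun_eq_iff algebra_simps)

lemma divergence_pole_field:
  "divergence pole_field x = real CARD('n) * (defect x + (norm (x - x0))\<^sup>2)"
proof -
  have "divergence pole_field x = (\<Sum>b\<in>(Basis :: (real^'n) set). defect x + (norm (x - x0))\<^sup>2)"
    unfolding divergence_eqI[OF pole_field_has_derivative]
    by (intro sum.cong) (simp_all add: inner_add_left inner_diff_left inner_diff_right
        inner_commute algebra_simps)
  then show ?thesis by simp
qed

lemma inner_pole_field:
  "x \<bullet> pole_field x
    = defect x * (defect x0 - defect x + (norm (x - x0))\<^sup>2) / 2 + (norm (x - x0))\<^sup>2 * (1 - defect x)"
  by (simp add: pole_field_def inner_add_right inner_self_eq_defect flip: two_inner_pole_diff)

lemma hlaplace_cosh_dist: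
  assumes "x \<in> hball"
  shows "hlaplace cosh_dist x = real CARD('n) * cosh_dist x"
proof -
  define D where "D = (2 * real CARD('n) / defect x * hdens x / defect x0) *\<^sub>R x"
  have D: "GDERIV (\<lambda>x. hdens x / defect x0) x :> D"
    using GDERIV_mult[OF GDERIV_hdens[OF assms] GDERIV_const[of "inverse (defect x0)"]]
    by (simp add: D_def divide_inverse mult_ac)
  have "divergence (\<lambda>x. (hdens x * (defect x / 2)\<^sup>2) *\<^sub>R grad cosh_dist x) x
      = divergence (\<lambda>x. (hdens x / defect x0) *\<^sub>R pole_field x) x"
  proof (rule divergence_transform_within_open[OF _ open_hball assms, symmetric])
    show "(hdens y / defect x0) *\<^sub>R pole_field y = (hdens y * (defect y / 2)\<^sup>2) *\<^sub>R grad cosh_dist y"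
      if "y \<in> hball" for y
      using defect_pos[OF that] by (simp add: grad_cosh_dist[OF that] power2_eq_square)
  qed (rule has_derivative_scaleR[OF D[unfolded gderiv_def] pole_field_has_derivative])
  also have "\<dots> = hdens x / defect x0 * divergence pole_field x + D \<bullet> pole_field x"
    by (rule divergence_scaleR[OF D pole_field_has_derivative])
  also have "\<dots> = real CARD('n) * cosh_dist x * hdens x"
    unfolding D_def divergence_pole_field inner_scaleR_left inner_pole_field cosh_dist_def
    using defect_pos[OF assms] defect_pole_pos by (simp add: field_simps)
  finally show ?thesis
    using hdens_pos[OF assms] by (simp add: hlaplace_def)
qed

lemma Ck_on_radial: "Ck_on k {0<..} f \<Longrightarrow> Ck_on k \<Omega> (\<lambda>x. f (r x))"
  by (rule Ck_on_compose[where I = "{0<..}", OF _ _ Ck_on_r]) (simp_all add: r_pos)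

lemma GDERIV_radial:
  assumes "x \<in> \<Omega>" "(f has_real_derivative f') (at (r x))"
  shows "GDERIV (\<lambda>x. f (r x)) x :> f' *\<^sub>R grad r x"
  by (rule GDERIV_DERIV_compose[OF GDERIV_r[OF assms(1)] assms(2)])

lemma hgrad_inner_radial_left:
  assumes "x \<in> \<Omega>" "(f has_real_derivative f') (at (r x))"
  shows "hgrad_inner (\<lambda>x. f (r x)) v x = f' * hgrad_inner r v x"
  by (simp add: hgrad_inner_def grad_eqI[OF GDERIV_radial[OF assms]])

lemma hgrad_inner_cosh_dist_right:
  "x \<in> \<Omega> \<Longrightarrow> hgrad_inner w cosh_dist x = sinh (r x) * hgrad_inner w r x"
  by (simp add: hgrad_inner_def grad_cosh_dist_eq_grad_r)

lemma hgrad_inner_mult_radial_cosh_dist: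
  assumes x: "x \<in> \<Omega>" and w: "GDERIV w x :> D" and H: "(H has_real_derivative H') (at (r x))"
  shows "hgrad_inner (\<lambda>x. w x * (H (r x) / sinh (r x))) cosh_dist x
    = H (r x) * hgrad_inner w r x + w x * (H' - cosh (r x) / sinh (r x) * H (r x))"
proof -
  define Q where "Q t = H t / sinh t" for t
  have "(Q has_real_derivative (H' * sinh (r x) - H (r x) * cosh (r x)) / (sinh (r x))\<^sup>2) (at (r x))"
    unfolding Q_def[abs_def] using H sinh_r_pos[OF x]
    by (auto intro!: derivative_eq_intros simp: power2_eq_square)
  then have "hgrad_inner (\<lambda>x. w x * Q (r x)) r x
      = w x * ((H' * sinh (r x) - H (r x) * cosh (r x)) / (sinh (r x))\<^sup>2) + Q (r x) * hgrad_inner w r x"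
    by (simp add: hgrad_inner_mult_left[OF w GDERIV_radial[OF x]]
        hgrad_inner_radial_left[OF x] eikonal[OF x])
  then show ?thesis
    unfolding Q_def hgrad_inner_cosh_dist_right[OF x]
    using sinh_r_pos[OF x] by (simp add: field_simps power2_eq_square)
qed

text \<open>Green's identity for \<open>cosh r\<close>, tested against \<open>w H(r) / sinh r\<close>.\<close>

lemma hint_radial_by_parts:
  assumes w: "w \<in> Cck 1 \<Omega>"
    and H: "\<And>t. 0 < t \<Longrightarrow> (H has_real_derivative H' t) (at t)" "continuous_on {0<..} H'"
  defines "I \<equiv> \<lambda>x. H (r x) * hgrad_inner w r x
      + w x * (H' (r x) + (real CARD('n) - 1) * (cosh (r x) / sinh (r x)) * H (r x))"
  shows "hintegrable I" "hint I = 0"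
proof -
  define W where "W x = w x * (H (r x) / sinh (r x))" for x
  have "Ck_on 1 {0<..} H"
    unfolding One_nat_def by (rule Ck_on_derivI) (use H in auto)
  then have "Ck_on 1 {0<..} (\<lambda>t. H t / sinh t)"
    unfolding divide_inverse
    by (intro Ck_on_mult Ck_on_compose[OF _ Ck_on_inverse Ck_on_sinh_cosh(1)]) auto
  then have W: "W \<in> Cck 1 \<Omega>"
    unfolding W_def[abs_def] by (intro Cck_mult[OF open_Omega w] Ck_on_radial)
  have "hgrad_inner W cosh_dist x + W x * hlaplace cosh_dist x = I x" for x
  proof (cases "x \<in> \<Omega>")
    case True
    then have "hlaplace cosh_dist x = real CARD('n) * cosh (r x)"
      using Omega_subset by (simp add: hlaplace_cosh_dist subset_eq cosh_r)
    then show ?thesis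
      unfolding W_def[abs_def] I_def
        hgrad_inner_mult_radial_cosh_dist[OF True Cck_1D(1)[OF w] H(1)[OF r_pos[OF True]]]
      by (simp add: algebra_simps diff_divide_distrib)
  next
    case False
    then show ?thesis
      by (simp add: I_def W_def hgrad_inner_def Cck_eq_0[OF w] grad_Cck_eq_0[OF w] grad_Cck_eq_0[OF W])
  qed
  then show "hintegrable I" "hint I = 0"
    using hint_green[OF open_Omega Omega_subset W Ck_on_subset[OF Ck_on_cosh_dist Omega_subset]] by simp_all
qed

end

subsection \<open>The ground state\<close>

definition hardy_pot :: "real \<Rightarrow> real \<Rightarrow> real" where
  "hardy_pot d t = (d - 1)\<^sup>2 / 4 + 1 / 4 / t\<^sup>2 + (d - 1) * (d - 3) / 4 / (sinh t)\<^sup>2"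

definition ground :: "real \<Rightarrow> real \<Rightarrow> real" where
  "ground d t = t powr (1 / 2) * sinh t powr ((1 - d) / 2)"

definition ground_logder :: "real \<Rightarrow> real \<Rightarrow> real" where
  "ground_logder d t = 1 / (2 * t) - (d - 1) / 2 * (cosh t / sinh t)"

lemma ground_pos: "0 < t \<Longrightarrow> 0 < ground d t"
  by (simp add: ground_def)

lemma has_real_derivative_powr_logder:
  assumes "(f has_real_derivative f') (at t)" "0 < f t"
  shows "((\<lambda>t. f t powr a) has_real_derivative a * (f' / f t) * f t powr a) (at t)"
  using DERIV_fun_powr[OF assms, of a] assms(2) by (simp add: powr_diff mult_ac)

lemma ground_has_derivative:
  assumes "0 < t"
  shows "(ground d has_real_derivative ground_logder d t * ground d t) (at t)"
proof -
  have "((\<lambda>t. t powr (1 / 2)) has_real_derivative 1 / 2 * (1 / t) * t powr (1 / 2)) (at t)"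
    by (rule has_real_derivative_powr_logder[OF DERIV_ident assms])
  moreover have "((\<lambda>t. sinh t powr ((1 - d) / 2)) has_real_derivative
      (1 - d) / 2 * (cosh t / sinh t) * sinh t powr ((1 - d) / 2)) (at t)"
    by (rule has_real_derivative_powr_logder) (use assms in \<open>auto intro!: derivative_eq_intros\<close>)
  ultimately have "(ground d has_real_derivative
      1 / 2 * (1 / t) * t powr (1 / 2) * sinh t powr ((1 - d) / 2)
      + (1 - d) / 2 * (cosh t / sinh t) * sinh t powr ((1 - d) / 2) * t powr (1 / 2)) (at t)"
    unfolding ground_def[abs_def] by (rule DERIV_mult)
  then show ?thesis
    by (rule DERIV_cong) (simp add: ground_def ground_logder_def algebra_simps flip: add_divide_distrib)
qed

lemma Ck_on_ground: "Ck_on k {0<..} (ground d)"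
  unfolding ground_def[abs_def]
  by (intro Ck_on_mult Ck_on_powr Ck_on_compose[OF _ Ck_on_powr Ck_on_sinh_cosh(1)]) auto

lemma powr_one_minus_of_nat:
  assumes "0 < x" "0 < m"
  shows "x powr (1 - real m) = 1 / x ^ (m - 1)"
proof -
  have "x powr (1 - real m) = x powr - real (m - 1)"
    using assms(2) by (simp add: of_nat_diff)
  then show ?thesis
    using assms(1) by (simp only: powr_minus powr_realpow inverse_eq_divide)
qed

lemma ground_sq:
  assumes "0 < t" "0 < m"
  shows "(ground (real m) t)\<^sup>2 = t / sinh t ^ (m - 1)"
proof -
  have "(ground (real m) t)\<^sup>2 = t * sinh t powr (1 - real m)"
    using assms(1) by (simp add: ground_def power_mult_distrib powr_power diff_divide_distrib)
  then show ?thesis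
    using assms by (simp add: powr_one_minus_of_nat)
qed

lemma ground_logder_has_derivative:
  assumes "0 < t"
  shows "(ground_logder d has_real_derivative - 1 / (2 * t\<^sup>2) + (d - 1) / 2 / (sinh t)\<^sup>2) (at t)"
proof -
  have sinh_pos: "0 < sinh t" using assms by simp
  have "cosh t * cosh t = 1 + sinh t * sinh t"
    using cosh_square_eq[of t] by (simp add: power2_eq_square)
  then have "((\<lambda>t. cosh t / sinh t) has_real_derivative - 1 / (sinh t)\<^sup>2) (at t)"
    using sinh_pos by (auto intro!: derivative_eq_intros simp: power2_eq_square field_simps)
  moreover have "((\<lambda>t. 1 / (2 * t)) has_real_derivative - 1 / (2 * t\<^sup>2)) (at t)"
    using assms by (auto intro!: derivative_eq_intros simp: power2_eq_square field_simps)
  ultimately have "((\<lambda>t. 1 / (2 * t) - (d - 1) / 2 * (cosh t / sinh t)) has_real_derivative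
      - 1 / (2 * t\<^sup>2) - (d - 1) / 2 * (- 1 / (sinh t)\<^sup>2)) (at t)"
    by (intro DERIV_diff DERIV_cmult)
  then show ?thesis unfolding ground_logder_def[abs_def] by simp
qed

lemma ground_logder_riccati:
  assumes "0 < t"
  shows "(- 1 / (2 * t\<^sup>2) + (d - 1) / 2 / (sinh t)\<^sup>2) + (d - 1) * (cosh t / sinh t) * ground_logder d t
    = - hardy_pot d t - (ground_logder d t)\<^sup>2"
proof -
  have sinh_pos: "0 < sinh t" using assms by simp
  define y q z where "y = 1 / t" and "q = cosh t / sinh t" and "z = 1 / (sinh t)\<^sup>2"
  have "(- (y\<^sup>2 / 2) + (d - 1) / 2 * z) + (d - 1) * q * (y / 2 - (d - 1) / 2 * q)
      = - ((d - 1)\<^sup>2 / 4 + y\<^sup>2 / 4 + (d - 1) * (d - 3) / 4 * z) - (y / 2 - (d - 1) / 2 * q)\<^sup>2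
        + (d - 1)\<^sup>2 / 4 * (1 + z - q\<^sup>2)"
    by (simp add: power2_eq_square field_simps)
  also have "q\<^sup>2 = 1 + z"
    using sinh_pos by (simp add: q_def z_def power_divide cosh_square_eq add_divide_distrib)
  also have "y / 2 - (d - 1) / 2 * q = ground_logder d t"
    by (simp add: ground_logder_def y_def q_def)
  also have "(d - 1)\<^sup>2 / 4 + y\<^sup>2 / 4 + (d - 1) * (d - 3) / 4 * z = hardy_pot d t"
    by (simp add: hardy_pot_def y_def z_def power_divide)
  also have "- (y\<^sup>2 / 2) + (d - 1) / 2 * z = - 1 / (2 * t\<^sup>2) + (d - 1) / 2 / (sinh t)\<^sup>2"
    by (simp add: y_def z_def power_divide)
  finally show ?thesis by (simp add: q_def)
qed

lemma sinh_le_mult_cosh: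
  assumes "0 \<le> (t::real)"
  shows "sinh t \<le> t * cosh t"
proof -
  have "(\<lambda>t. t * cosh t - sinh t) 0 \<le> (\<lambda>t. t * cosh t - sinh t) t"
  proof (rule DERIV_nonneg_imp_nondecreasing[OF assms])
    fix x :: real assume "0 \<le> x"
    moreover have "((\<lambda>t. t * cosh t - sinh t) has_real_derivative x * sinh x) (at x)"
      by (auto intro!: derivative_eq_intros)
    ultimately show "\<exists>y. ((\<lambda>t. t * cosh t - sinh t) has_real_derivative y) (at x) \<and> 0 \<le> y"
      by (auto intro!: exI[of _ "x * sinh x"])
  qed
  then show ?thesis by simp
qed

lemma ground_logder_nonpos:
  assumes "0 < t" "2 \<le> d"
  shows "ground_logder d t \<le> 0"
proof -
  have sinh_pos: "0 < sinh t" using assms by simp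
  have "1 / t \<le> cosh t / sinh t"
    using sinh_le_mult_cosh[of t] sinh_pos assms by (simp add: field_simps)
  also have "\<dots> \<le> (d - 1) * (cosh t / sinh t)"
    using sinh_pos assms by (intro mult_right_mono[of 1 "d - 1", simplified]) auto
  finally have "1 / t / 2 \<le> (d - 1) * (cosh t / sinh t) / 2" by (rule divide_right_mono) simp
  then show ?thesis by (simp add: ground_logder_def mult.commute)
qed

lemma hardy_pot_nonneg: "3 \<le> d \<Longrightarrow> 0 \<le> hardy_pot d t"
  by (simp add: hardy_pot_def)

lemma continuous_on_hardy_pot: "continuous_on {0<..} (hardy_pot d)"
  unfolding hardy_pot_def[abs_def] by (auto intro!: continuous_intros)

context hyperbolic_pole
begin

abbreviation pot :: "real^'n \<Rightarrow> real" where
  "pot x \<equiv> hardy_pot (real CARD('n)) (r x)"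

abbreviation logder :: "real^'n \<Rightarrow> real" where
  "logder x \<equiv> ground_logder (real CARD('n)) (r x)"

definition ground_state_energy :: "(real^'n \<Rightarrow> real) \<Rightarrow> real^'n \<Rightarrow> real" where
  "ground_state_energy u x = (defect x / 2 * norm (grad u x - (logder x * u x) *\<^sub>R grad r x))\<^sup>2"

lemma ground_state_energy_nonneg: "0 \<le> ground_state_energy u x"
  by (simp add: ground_state_energy_def)

lemma ground_state_energy_Cck_eq_0: "u \<in> Cck 1 S \<Longrightarrow> x \<notin> S \<Longrightarrow> ground_state_energy u x = 0"
  by (simp add: ground_state_energy_def Cck_eq_0[of u 1 S] grad_Cck_eq_0[of u S])

lemma ground_state_energy_eq:
  assumes "x \<in> \<Omega>"
  shows "ground_state_energy u x
    = hgrad_sq u x - logder x * (2 * u x * hgrad_inner u r x) + (logder x)\<^sup>2 * (u x)\<^sup>2"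
proof -
  have "ground_state_energy u x
      = hgrad_inner u u x - 2 * (logder x * u x) * hgrad_inner u r x
        + (logder x * u x)\<^sup>2 * hgrad_inner r r x"
    unfolding ground_state_energy_def hgrad_inner_def power_mult_distrib power2_norm_eq_inner
    by (simp add: inner_diff inner_commute power2_eq_square algebra_simps)
  then show ?thesis
    by (simp add: hgrad_sq_eq eikonal[OF assms] power_mult_distrib)
qed

lemma hint_ground_by_parts:
  assumes w: "w \<in> Cck 1 \<Omega>"
  defines "I \<equiv> \<lambda>x. logder x * hgrad_inner w r x - (pot x + (logder x)\<^sup>2) * w x"
  shows "hintegrable I" "hint I = 0"
proof -
  define d where "d = real CARD('n)"
  define g' where "g' t = - 1 / (2 * t\<^sup>2) + (d - 1) / 2 / (sinh t)\<^sup>2" for t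
  have g': "(ground_logder d has_real_derivative g' t) (at t)" if "0 < t" for t
    unfolding g'_def by (rule ground_logder_has_derivative[OF that])
  have g'_cont: "continuous_on {0<..} g'"
    unfolding g'_def[abs_def] by (auto intro!: continuous_intros)
  have "w x * (g' (r x) + (d - 1) * (cosh (r x) / sinh (r x)) * ground_logder d (r x))
      = - ((pot x + (logder x)\<^sup>2) * w x)" for x
  proof (cases "x \<in> \<Omega>")
    case True
    then show ?thesis
      unfolding g'_def ground_logder_riccati[OF r_pos[OF True]] by (simp add: d_def algebra_simps)
  next
    case False
    then show ?thesis by (simp add: Cck_eq_0[OF w])
  qed
  then show "hintegrable I" "hint I = 0"
    using hint_radial_by_parts[OF w g' g'_cont] unfolding I_def d_def by simp_all
qed

lemma ground_state_representation:
  assumes u: "u \<in> Cck 1 \<Omega>"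
  shows "hint (hgrad_sq u) - hint (\<lambda>x. pot x * (u x)\<^sup>2) = hint (ground_state_energy u)"
proof -
  define I where "I x = logder x * hgrad_inner (\<lambda>x. (u x)\<^sup>2) r x - (pot x + (logder x)\<^sup>2) * (u x)\<^sup>2" for x
  have u2: "(\<lambda>x. (u x)\<^sup>2) \<in> Cck 1 \<Omega>"
    unfolding power2_eq_square by (rule Cck_mult[OF open_Omega u Cck_Ck_on[OF u]])
  have I: "hintegrable I" "hint I = 0"
    using hint_ground_by_parts[OF u2] unfolding I_def[abs_def] by auto
  have energy: "hintegrable (hgrad_sq u)"
    by (rule hintegrable_hgrad_sq[OF Cck_mono[OF u Omega_subset]])
  have pot: "hintegrable (\<lambda>x. pot x * (u x)\<^sup>2)"
    by (intro hintegrable_Cck_mult[OF u2 Omega_subset] continuous_on_radial continuous_on_hardy_pot)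
  have "ground_state_energy u x = hgrad_sq u x - pot x * (u x)\<^sup>2 - I x" for x
  proof (cases "x \<in> \<Omega>")
    case True
    then show ?thesis
      by (simp add: ground_state_energy_eq I_def hgrad_inner_power2_left[OF Cck_1D(1)[OF u]] algebra_simps)
  next
    case False
    then show ?thesis
      by (simp add: ground_state_energy_Cck_eq_0[OF u] I_def hgrad_sq_eq hgrad_inner_def
          Cck_eq_0[OF u] grad_Cck_eq_0[OF u] grad_Cck_eq_0[OF u2])
  qed
  then have "ground_state_energy u = (\<lambda>x. (hgrad_sq u x - pot x * (u x)\<^sup>2) - I x)" by auto
  then show ?thesis
    using energy pot I by (simp add: hint_diff hintegrable_diff)
qed

end

subsection \<open>The Hardy inequality\<close>

lemma integral_monotone_convergence_bounded:
  fixes f :: "nat \<Rightarrow> 'a \<Rightarrow> real"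
  assumes int: "\<And>n. integrable M (f n)" and mono: "AE x in M. mono (\<lambda>n. f n x)"
    and nonneg: "\<And>n. AE x in M. 0 \<le> f n x" and lim: "AE x in M. (\<lambda>n. f n x) \<longlonglongrightarrow> F x"
    and F: "F \<in> borel_measurable M" and bound: "\<And>n. integral\<^sup>L M (f n) \<le> C"
  shows "integrable M F" "integral\<^sup>L M F \<le> C"
proof -
  have "incseq (\<lambda>n. integral\<^sup>L M (f n))"
  proof (rule incseq_SucI)
    show "integral\<^sup>L M (f n) \<le> integral\<^sup>L M (f (Suc n))" for n
      using mono by (intro integral_mono_AE int) (auto simp: mono_iff_le_Suc)
  qed
  then obtain l where l: "(\<lambda>n. integral\<^sup>L M (f n)) \<longlonglongrightarrow> l"
    using incseq_convergent bound by blast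
  note monotone = integral_monotone_convergence_nonneg[OF int mono nonneg lim l F]
  show "integrable M F" by (rule monotone)
  show "integral\<^sup>L M F \<le> C"
    unfolding monotone by (rule LIMSEQ_le_const2[OF l]) (use bound in auto)
qed

definition pole_cutoff :: "nat \<Rightarrow> real \<Rightarrow> real" where
  "pole_cutoff n t = flat_exp 0 (real (Suc n) * t - 1)"

lemma pole_cutoff_nonneg: "0 \<le> pole_cutoff n t"
  by (simp add: pole_cutoff_def flat_exp_nonneg)

lemma pole_cutoff_le_1: "pole_cutoff n t \<le> 1"
  by (simp add: pole_cutoff_def flat_exp_0_le_1)

lemma pole_cutoff_eq_0: "t \<le> 1 / real (Suc n) \<Longrightarrow> pole_cutoff n t = 0"
  by (simp add: pole_cutoff_def flat_exp_eq_0 field_simps)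

lemma pole_cutoff_mono: "m \<le> n \<Longrightarrow> 0 \<le> t \<Longrightarrow> pole_cutoff m t \<le> pole_cutoff n t"
  unfolding pole_cutoff_def by (intro flat_exp_0_mono) (simp add: mult_right_mono)

lemma pole_cutoff_tendsto_1:
  assumes "0 < t"
  shows "(\<lambda>n. pole_cutoff n t) \<longlonglongrightarrow> 1"
proof -
  have "filterlim (\<lambda>n. real (Suc n) * t - 1) at_top sequentially"
    using assms by real_asymp
  then show ?thesis
    unfolding pole_cutoff_def by (rule filterlim_compose[OF flat_exp_0_tendsto_1])
qed

lemma pole_cutoff_has_derivative:
  "(pole_cutoff n has_real_derivative flat_exp 2 (real (Suc n) * t - 1) * real (Suc n)) (at t)"
  unfolding pole_cutoff_def[abs_def]
  by (rule DERIV_chain2[OF flat_exp_0_has_derivative]) (auto intro!: derivative_eq_intros)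

context hyperbolic_pole
begin

lemma cutoff_mult_sq_in_Cck:
  assumes u: "u \<in> Cck 1 hball" and \<theta>: "Ck_on 1 {0<..} \<theta>"
    and a: "0 < a" "\<And>t. t \<le> a \<Longrightarrow> \<theta> t = 0"
  shows "(\<lambda>x. \<theta> (r x) * (u x)\<^sup>2) \<in> Cck 1 \<Omega>"
proof -
  obtain L where L: "compact L" "L \<subseteq> hball" "\<And>x. x \<notin> L \<Longrightarrow> u x = 0"
    using u by (auto simp: Cck_def)
  show ?thesis
  proof (rule CckI[OF open_Omega _ compact_ge_r[OF L(1,2) a(1)]])
    show "Ck_on 1 \<Omega> (\<lambda>x. \<theta> (r x) * (u x)\<^sup>2)"
      by (intro Ck_on_mult Ck_on_power Ck_on_radial \<theta> Cck_Ck_on[OF u])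
    show "\<theta> (r x) * (u x)\<^sup>2 = 0" if "x \<notin> {x \<in> L. a \<le> r x}" for x
      using that L(3)[of x] a(2)[of "r x"] by fastforce
  qed
qed

text \<open>Cutting off at the pole only helps: the cutoff increases along \<open>r\<close> while the logarithmic
  derivative of the ground state is nonpositive.\<close>

lemma ground_logder_cutoff_le_hgrad_sq:
  assumes dim: "2 \<le> CARD('n)" and x: "x \<in> \<Omega>" and u: "GDERIV u x :> D"
    and \<theta>: "(\<theta> has_real_derivative \<theta>') (at (r x))" "0 \<le> \<theta> (r x)" "\<theta> (r x) \<le> 1" "0 \<le> \<theta>'"
  shows "logder x * hgrad_inner (\<lambda>x. \<theta> (r x) * (u x)\<^sup>2) r x - (logder x)\<^sup>2 * (\<theta> (r x) * (u x)\<^sup>2)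
    \<le> hgrad_sq u x"
proof -
  have "hgrad_inner (\<lambda>x. \<theta> (r x) * (u x)\<^sup>2) r x
      = \<theta> (r x) * (2 * u x * hgrad_inner u r x) + (u x)\<^sup>2 * \<theta>'"
    using hgrad_inner_mult_left[OF GDERIV_radial[OF x \<theta>(1)] GDERIV_mult[OF u u]]
    by (simp add: hgrad_inner_power2_left[OF u] hgrad_inner_radial_left[OF x \<theta>(1)] eikonal[OF x]
        flip: power2_eq_square)
  then have "logder x * hgrad_inner (\<lambda>x. \<theta> (r x) * (u x)\<^sup>2) r x - (logder x)\<^sup>2 * (\<theta> (r x) * (u x)\<^sup>2)
      = \<theta> (r x) * (hgrad_sq u x - ground_state_energy u x) + logder x * ((u x)\<^sup>2 * \<theta>')"
    by (simp add: ground_state_energy_eq[OF x] algebra_simps)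
  also have "\<dots> \<le> 1 * hgrad_sq u x + 0"
  proof (rule add_mono)
    have "\<theta> (r x) * (hgrad_sq u x - ground_state_energy u x) \<le> \<theta> (r x) * hgrad_sq u x"
      using \<theta>(2) ground_state_energy_nonneg by (intro mult_left_mono) auto
    also have "\<dots> \<le> 1 * hgrad_sq u x"
      using \<theta>(3) hgrad_sq_nonneg by (intro mult_right_mono) auto
    finally show "\<theta> (r x) * (hgrad_sq u x - ground_state_energy u x) \<le> 1 * hgrad_sq u x" .
    have "logder x \<le> 0"
      using dim by (intro ground_logder_nonpos r_pos[OF x]) simp
    then show "logder x * ((u x)\<^sup>2 * \<theta>') \<le> 0"
      using \<theta>(4) by (intro mult_nonpos_nonneg) auto
  qed
  finally show ?thesis by simp
qed

lemma hardy_inequality_cutoff: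
  assumes dim: "2 \<le> CARD('n)" and u: "u \<in> Cck 1 hball"
    and \<theta>: "\<And>t. (\<theta> has_real_derivative \<theta>' t) (at t)" "continuous_on {0<..} \<theta>'"
      "\<And>t. 0 \<le> \<theta> t" "\<And>t. \<theta> t \<le> 1" "\<And>t. 0 \<le> \<theta>' t"
    and a: "0 < a" "\<And>t. t \<le> a \<Longrightarrow> \<theta> t = 0"
  defines "F \<equiv> \<lambda>x. pot x * (\<theta> (r x) * (u x)\<^sup>2)"
  shows "hintegrable F" "hint F \<le> hint (hgrad_sq u)"
proof -
  define w where "w x = \<theta> (r x) * (u x)\<^sup>2" for x
  have "Ck_on 1 {0<..} \<theta>"
    unfolding One_nat_def by (rule Ck_on_derivI) (use \<theta>(1,2) in auto)
  then have w: "w \<in> Cck 1 \<Omega>"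
    unfolding w_def[abs_def] by (rule cutoff_mult_sq_in_Cck[OF u _ a])
  define I where "I x = logder x * hgrad_inner w r x - (pot x + (logder x)\<^sup>2) * w x" for x
  have I: "hintegrable I" "hint I = 0"
    using hint_ground_by_parts[OF w] unfolding I_def[abs_def] by auto
  show F: "hintegrable F"
    unfolding F_def w_def[symmetric]
    by (intro hintegrable_Cck_mult[OF w Omega_subset] continuous_on_radial continuous_on_hardy_pot)
  have inside: "I x + F x \<le> hgrad_sq u x" if "x \<in> \<Omega>" for x
    using ground_logder_cutoff_le_hgrad_sq[OF dim that Cck_1D(1)[OF u] \<theta>(1,3-5)]
    by (simp add: I_def F_def w_def[abs_def] algebra_simps)
  have outside: "I x + F x = 0" if "x \<notin> \<Omega>" for x
    using that by (simp add: I_def F_def hgrad_inner_def Cck_eq_0[OF w] grad_Cck_eq_0[OF w] flip: w_def)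
  have "hint F = hint (\<lambda>x. I x + F x)"
    by (simp add: hint_add I F)
  also have "\<dots> \<le> hint (hgrad_sq u)"
  proof (rule hint_mono[OF hintegrable_add[OF I(1) F] hintegrable_hgrad_sq[OF u]])
    show "I x + F x \<le> hgrad_sq u x" for x
      using inside[of x] outside[of x] hgrad_sq_nonneg[of u x] by (cases "x \<in> \<Omega>") auto
    show "I x + F x = hgrad_sq u x" if "x \<notin> hball" for x
      using that outside Omega_subset by (auto simp: hgrad_sq_eq hgrad_inner_def grad_Cck_eq_0[OF u])
  qed
  finally show "hint F \<le> hint (hgrad_sq u)" .
qed

lemma hardy_inequality_pole_cutoff:
  fixes n :: nat
  assumes "2 \<le> CARD('n)" "u \<in> Cck 1 hball"
  defines "F \<equiv> \<lambda>x. pot x * (pole_cutoff n (r x) * (u x)\<^sup>2)"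
  shows "hintegrable F" "hint F \<le> hint (hgrad_sq u)"
proof -
  have cont: "continuous_on {0<..} (\<lambda>t. flat_exp 2 (real (Suc n) * t - 1) * real (Suc n))"
    by (intro continuous_intros
        continuous_on_compose2[OF Ck_on_imp_continuous_on[OF Ck_on_flat_exp[of 0 UNIV 2]]]) auto
  have nonneg: "0 \<le> flat_exp 2 (real (Suc n) * t - 1) * real (Suc n)" for t
    by (simp add: flat_exp_nonneg)
  have "0 < 1 / real (Suc n)" by simp
  note cutoff = hardy_inequality_cutoff[OF assms(1,2) pole_cutoff_has_derivative cont
      pole_cutoff_nonneg pole_cutoff_le_1 nonneg this pole_cutoff_eq_0]
  show "hintegrable F" "hint F \<le> hint (hgrad_sq u)"
    unfolding F_def using cutoff by blast+
qed

theorem hardy_inequality: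
  assumes dim: "3 \<le> CARD('n)" and u: "u \<in> Cck 1 hball"
  defines "F \<equiv> \<lambda>x. pot x * (u x)\<^sup>2"
  shows "hintegrable F" "hint F \<le> hint (hgrad_sq u)"
proof -
  define f where "f n x = pot x * (pole_cutoff n (r x) * (u x)\<^sup>2) * hdens x" for n x
  have f: "integrable lborel (f n)" "integral\<^sup>L lborel (f n) \<le> hint (hgrad_sq u)" for n
    using hardy_inequality_pole_cutoff[OF _ u, of n] dim
    unfolding hintegrable_def hint_def f_def[abs_def] by auto
  have f_eq: "f n x = pole_cutoff n (r x) * (F x * hdens x)" for n x
    by (simp add: f_def F_def mult_ac)
  note u_outside = Cck_eq_0[OF u]
  have F_nonneg: "0 \<le> F x * hdens x" for x
    using u_outside[of x] hdens_pos[of x] hardy_pot_nonneg[of "real CARD('n)" "r x"] dim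
    by (cases "x \<in> hball") (auto simp: F_def)
  have "F \<in> borel_measurable borel"
    unfolding F_def hardy_pot_def sinh_def
    using borel_measurable_r borel_measurable_continuous_onI[OF Cck_continuous_on[OF u]] by measurable
  then have F_meas: "(\<lambda>x. F x * hdens x) \<in> borel_measurable lborel"
    by (simp add: borel_measurable_times borel_measurable_hdens)
  have "mono (\<lambda>n. f n x)" for x
  proof (cases "x \<in> hball")
    case True
    then show ?thesis
      unfolding f_eq by (intro monoI mult_right_mono F_nonneg pole_cutoff_mono r_nonneg)
  qed (simp add: f_def u_outside mono_def)
  then have mono: "AE x in lborel. mono (\<lambda>n. f n x)" by simp
  have "(\<lambda>n. f n x) \<longlonglongrightarrow> F x * hdens x" if "x \<noteq> x0" for x
  proof (cases "x \<in> hball")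
    case True
    then have "0 < r x" using that r_pos by (auto simp: \<Omega>_def)
    from tendsto_mult_right[OF pole_cutoff_tendsto_1[OF this]] show ?thesis by (simp add: f_eq)
  qed (simp add: f_def F_def u_outside)
  then have lim: "AE x in lborel. (\<lambda>n. f n x) \<longlonglongrightarrow> F x * hdens x"
    using AE_lborel_singleton[of x0] by (auto elim: eventually_mono)
  have nonneg: "AE x in lborel. 0 \<le> f n x" for n
    by (simp add: f_eq pole_cutoff_nonneg F_nonneg)
  show "hintegrable F" "hint F \<le> hint (hgrad_sq u)"
    using integral_monotone_convergence_bounded[OF f(1) mono nonneg lim F_meas f(2)]
    unfolding hintegrable_def hint_def[of F] by auto
qed

lemma hint_three_term_weight:
  assumes "hintegrable (\<lambda>x. \<alpha> * (u x)\<^sup>2)" "hintegrable (\<lambda>x. \<beta> * ((u x)\<^sup>2 / (r x)\<^sup>2))"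
    "hintegrable (\<lambda>x. \<gamma> * ((u x)\<^sup>2 / (sinh (r x))\<^sup>2))"
  shows "hint (\<lambda>x. (\<alpha> + \<beta> / (r x)\<^sup>2 + \<gamma> / (sinh (r x))\<^sup>2) * (u x)\<^sup>2)
    = \<alpha> * hint (\<lambda>x. (u x)\<^sup>2) + \<beta> * hint (\<lambda>x. (u x)\<^sup>2 / (r x)\<^sup>2)
      + \<gamma> * hint (\<lambda>x. (u x)\<^sup>2 / (sinh (r x))\<^sup>2)"
proof -
  have "hint (\<lambda>x. (\<alpha> + \<beta> / (r x)\<^sup>2 + \<gamma> / (sinh (r x))\<^sup>2) * (u x)\<^sup>2)
      = hint (\<lambda>x. (\<alpha> * (u x)\<^sup>2 + \<beta> * ((u x)\<^sup>2 / (r x)\<^sup>2)) + \<gamma> * ((u x)\<^sup>2 / (sinh (r x))\<^sup>2))"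
    by (simp add: distrib_right)
  also have "\<dots> = (hint (\<lambda>x. \<alpha> * (u x)\<^sup>2) + hint (\<lambda>x. \<beta> * ((u x)\<^sup>2 / (r x)\<^sup>2)))
      + hint (\<lambda>x. \<gamma> * ((u x)\<^sup>2 / (sinh (r x))\<^sup>2))"
    using assms by (simp only: hint_add hintegrable_add)
  finally show ?thesis by (simp only: hint_cmult)
qed

lemma hint_hardy_pot:
  assumes dim: "3 \<le> CARD('n)" and u: "u \<in> Cck 1 hball"
  defines "d \<equiv> real CARD('n)"
  shows "hint (\<lambda>x. hardy_pot d (r x) * (u x)\<^sup>2) = (d - 1)\<^sup>2 / 4 * hint (\<lambda>x. (u x)\<^sup>2)
    + 1 / 4 * hint (\<lambda>x. (u x)\<^sup>2 / (r x)\<^sup>2) + (d - 1) * (d - 3) / 4 * hint (\<lambda>x. (u x)\<^sup>2 / (sinh (r x))\<^sup>2)"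
proof -
  have nonneg: "0 \<le> (d - 1) * (d - 3) / 4" using dim by (simp add: d_def)
  have bound: "hintegrable (\<lambda>x. p (r x) * (u x)\<^sup>2)"
    if p: "p \<in> borel_measurable borel" "\<And>t. 0 \<le> p t" "\<And>t. p t \<le> hardy_pot d t" for p
  proof (rule hintegrable_bound[OF hardy_inequality(1)[OF dim u]])
    show "(\<lambda>x. p (r x) * (u x)\<^sup>2) \<in> borel_measurable borel"
      using borel_measurable_r p(1)
          borel_measurable_continuous_onI[OF Cck_continuous_on[OF u]] by measurable
    show "\<bar>p (r x) * (u x)\<^sup>2\<bar> \<le> \<bar>pot x * (u x)\<^sup>2\<bar>" for x
      using p(2,3)[of "r x"] by (simp add: d_def abs_mult mult_right_mono)
  qed
  show ?thesis
    unfolding hardy_pot_def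
  proof (rule hint_three_term_weight)
    show "hintegrable (\<lambda>x. (d - 1)\<^sup>2 / 4 * (u x)\<^sup>2)"
      by (rule bound) (use nonneg in \<open>auto simp: hardy_pot_def\<close>)
    show "hintegrable (\<lambda>x. 1 / 4 * ((u x)\<^sup>2 / (r x)\<^sup>2))"
      using bound[of "\<lambda>t. 1 / 4 / t\<^sup>2"] nonneg by (simp add: hardy_pot_def)
    have "(\<lambda>t. (d - 1) * (d - 3) / 4 / (sinh t)\<^sup>2) \<in> borel_measurable borel"
      unfolding sinh_def by measurable
    then show "hintegrable (\<lambda>x. (d - 1) * (d - 3) / 4 * ((u x)\<^sup>2 / (sinh (r x))\<^sup>2))"
      using bound[of "\<lambda>t. (d - 1) * (d - 3) / 4 / (sinh t)\<^sup>2"] nonneg by (simp add: hardy_pot_def)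
  qed
qed

end

subsection \<open>Integration in polar coordinates\<close>

definition Cck_pos :: "nat \<Rightarrow> (real \<Rightarrow> real) set" where
  "Cck_pos k = {f. Ck_on k {0<..} f \<and> (\<exists>a b. 0 < a \<and> (\<forall>t>0. t \<notin> {a..b} \<longrightarrow> f t = 0))}"

lemma Cck_posI:
  "Ck_on k {0<..} f \<Longrightarrow> 0 < a \<Longrightarrow> (\<And>t. 0 < t \<Longrightarrow> t \<notin> {a..b} \<Longrightarrow> f t = 0) \<Longrightarrow> f \<in> Cck_pos k"
  unfolding Cck_pos_def by blast

lemma Cck_posE:
  assumes "f \<in> Cck_pos k"
  obtains a b where "Ck_on k {0<..} f" "0 < a" "\<And>t. 0 < t \<Longrightarrow> t \<notin> {a..b} \<Longrightarrow> f t = 0"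
  using assms unfolding Cck_pos_def by blast

lemma Cck_pos_mult:
  assumes "f \<in> Cck_pos k" "Ck_on k {0<..} g"
  shows "(\<lambda>t. f t * g t) \<in> Cck_pos k"
proof -
  obtain a b where f: "Ck_on k {0<..} f" "0 < a" "\<And>t. 0 < t \<Longrightarrow> t \<notin> {a..b} \<Longrightarrow> f t = 0"
    using assms(1) by (rule Cck_posE) blast
  show ?thesis
    by (rule Cck_posI[OF Ck_on_mult[OF f(1) assms(2)] f(2), of b]) (simp add: f(3))
qed

lemma Cck_pos_diff:
  assumes "f \<in> Cck_pos k" "g \<in> Cck_pos k"
  shows "(\<lambda>t. f t - g t) \<in> Cck_pos k"
proof -
  obtain a b where f: "Ck_on k {0<..} f" "0 < a" "\<And>t. 0 < t \<Longrightarrow> t \<notin> {a..b} \<Longrightarrow> f t = 0"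
    using assms(1) by (rule Cck_posE) blast
  obtain a' b' where g: "Ck_on k {0<..} g" "0 < a'" "\<And>t. 0 < t \<Longrightarrow> t \<notin> {a'..b'} \<Longrightarrow> g t = 0"
    using assms(2) by (rule Cck_posE) blast
  show ?thesis
  proof (rule Cck_posI[OF Ck_on_diff[OF f(1) g(1)]])
    show "0 < min a a'" using f(2) g(2) by simp
    show "f t - g t = 0" if "0 < t" "t \<notin> {min a a'..max b b'}" for t
    proof -
      have "t \<notin> {a..b}" "t \<notin> {a'..b'}" using that(2) by auto
      then show ?thesis using that(1) by (simp add: f(3) g(3))
    qed
  qed
qed

lemma Cck_pos_0_integrable:
  assumes "f \<in> Cck_pos 0"
  shows "f integrable_on {0<..}"
proof -
  obtain a b where f: "Ck_on 0 {0<..} f" "0 < a" "\<And>t. 0 < t \<Longrightarrow> t \<notin> {a..b} \<Longrightarrow> f t = 0"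
    using assms by (rule Cck_posE) blast
  have "f integrable_on {a..b}"
    using f(2)
      by (intro integrable_continuous_real continuous_on_subset[OF Ck_on_imp_continuous_on[OF f(1)]]) auto
  then show ?thesis
    by (rule integrable_spike_set)
      (use f(2,3) in \<open>auto intro!: negligible_subset[OF negligible_empty]\<close>)
qed

lemma integral_eq_integral_support:
  fixes f :: "real \<Rightarrow> real"
  assumes "S \<subseteq> T" "\<And>t. t \<in> T - S \<Longrightarrow> f t = 0"
  shows "integral T f = integral S f"
  using assms by (intro integral_spike_set) (auto intro: negligible_subset[OF negligible_empty])

lemma DERIV_zero_imp_eq_on_convex:
  assumes "convex S" "s \<in> S" "t \<in> S" "\<And>x. x \<in> S \<Longrightarrow> (f has_field_derivative 0) (at x)"
  shows "f s = f t"
  using has_field_derivative_zero_constant[OF assms(1) has_field_derivative_at_within[OF assms(4)]]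
    assms(2,3)
  by metis

lemma antiderivative_greaterThan:
  fixes f :: "real \<Rightarrow> real"
  assumes "continuous_on {a<..} f"
  obtains F where "\<And>t. a < t \<Longrightarrow> (F has_real_derivative f t) (at t)"
proof -
  have "\<exists>F. \<forall>t. ereal a < ereal t \<longrightarrow> ereal t < \<infinity> \<longrightarrow> (F has_vector_derivative f t) (at t)"
    using assms by (intro einterval_antiderivative)
      (auto simp: continuous_on_eq_continuous_at open_greaterThan)
  then show ?thesis
    using that by (auto simp: has_real_derivative_iff_has_vector_derivative)
qed

lemma Cck_pos_primitive:
  assumes f: "f \<in> Cck_pos k" and mean: "integral {0<..} f = 0"
  obtains P where "P \<in> Cck_pos (Suc k)" "\<And>t. 0 < t \<Longrightarrow> (P has_real_derivative f t) (at t)"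
proof -
  obtain a b where a: "0 < a" and f: "Ck_on k {0<..} f" "\<And>t. 0 < t \<Longrightarrow> t \<notin> {a..b} \<Longrightarrow> f t = 0"
    using f by (rule Cck_posE) blast
  obtain B where B: "\<And>t. 0 < t \<Longrightarrow> (B has_real_derivative f t) (at t)"
    using antiderivative_greaterThan[OF Ck_on_imp_continuous_on[OF f(1)]] by blast
  have const: "B s = B t" if S: "convex S" "S \<subseteq> {0<..} - {a..b}" "s \<in> S" "t \<in> S" for S s t
  proof (rule DERIV_zero_imp_eq_on_convex[OF S(1,3,4)])
    fix x assume "x \<in> S"
    then have "0 < x" "x \<notin> {a..b}" using S(2) by auto
    with B[of x] f(2)[of x] show "(B has_real_derivative 0) (at x)" by simp
  qed
  define c where "c = max a b + 1"
  have c: "a / 2 \<le> c" "a < c" "b < c" using a by (auto simp: c_def)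
  have "(f has_integral B c - B (a / 2)) {a / 2..c}"
    by (rule fundamental_theorem_of_calculus[OF c(1)])
      (use a B in \<open>auto simp: has_real_derivative_iff_has_vector_derivative[symmetric]
        intro: has_field_derivative_at_within\<close>)
  moreover have "integral {0<..} f = integral {a / 2..c} f"
    using a c f(2) by (intro integral_eq_integral_support) auto
  ultimately have ends: "B c = B (a / 2)"
    using mean by (simp add: has_integral_iff)
  define P where "P t = B t - B (a / 2)" for t
  have P: "(P has_real_derivative f t) (at t)" if "0 < t" for t
    unfolding P_def[abs_def] using DERIV_diff[OF B[OF that] DERIV_const] by simp
  have "P t = 0" if "0 < t" "t \<notin> {a..b}" for t
  proof (cases "t < a")
    case True
    have "B t = B (a / 2)"
      by (rule const[of "{0<..<a}"]) (use True a that(1) in auto)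
    then show ?thesis by (simp add: P_def)
  next
    case False
    have "B t = B c"
      by (rule const[of "{max 0 b<..}"]) (use False a c that in auto)
    then show ?thesis by (simp add: P_def ends)
  qed
  moreover have "Ck_on (Suc k) {0<..} P"
    by (rule Ck_on_derivI[OF _ f(1)]) (simp add: P)
  ultimately show ?thesis
    using P that Cck_posI[OF _ a, of "Suc k" P b] by blast
qed

lemma hint_pos:
  fixes f :: "real^'n \<Rightarrow> real"
  assumes f: "f \<in> Cck 0 hball" and nonneg: "\<And>x. 0 \<le> f x" and pos: "0 < f x"
  shows "0 < hint f"
proof -
  note outside = Cck_eq_0[OF f]
  have weight: "0 \<le> f x * hdens x" for x
    using outside nonneg[of x] hdens_pos[of x] by (cases "x \<in> hball") auto
  have int: "integrable lborel (\<lambda>x. f x * hdens x)"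
    using hintegrable_Cck_mult[OF f subset_refl continuous_on_const, of 1] by (simp add: hintegrable_def)
  have "hint f \<noteq> 0"
  proof
    assume "hint f = 0"
    then have "AE x in lborel. f x * hdens x = 0"
      using integral_nonneg_eq_0_iff_AE[OF int] weight by (simp add: hint_def)
    then have "AE x in lborel. x \<notin> {x. f x \<noteq> 0}"
      by eventually_elim (use outside hdens_pos in force)
    moreover have open_support: "open {x. f x \<noteq> 0}"
      using Cck_continuous_on[OF f] by (intro open_Collect_neq continuous_on_const)
    ultimately have "{x. f x \<noteq> 0} \<in> null_sets lborel"
      by (simp add: AE_iff_null_sets)
    then have "negligible {x. f x \<noteq> 0}"
      using null_sets_completionI negligible_iff_null_sets by blast
    then show False
      using open_not_negligible[OF open_support] pos by force
  qed
  moreover have "0 \<le> hint f"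
    by (rule hint_nonneg[OF nonneg outside])
  ultimately show ?thesis by simp
qed

context hyperbolic_pole
begin

definition radial :: "(real \<Rightarrow> real) \<Rightarrow> real^'n \<Rightarrow> real" where
  "radial f x = (if x \<in> \<Omega> then f (r x) else 0)"

lemma radial_in_Cck_annulus:
  assumes f: "Ck_on k {0<..} f" and a: "0 < a" and supp: "\<And>t. 0 < t \<Longrightarrow> t \<notin> {a..b} \<Longrightarrow> f t = 0"
  shows "radial f \<in> Cck k (annulus a b)"
proof -
  have "Ck_on k \<Omega> (radial f)"
    using Ck_on_radial[OF f] Ck_on_cong[OF open_Omega, of "radial f" "\<lambda>x. f (r x)" k]
    by (simp add: radial_def)
  moreover have outside: "radial f x = 0" if "x \<notin> annulus a b" for x
    using that supp[of "r x"] r_pos[of x] Omega_subset by (auto simp: radial_def)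
  ultimately have "radial f \<in> Cck k \<Omega>"
    by (intro CckI[OF open_Omega _ compact_annulus[OF a]])
  then show ?thesis
    using outside compact_annulus(1)[OF a, of b] unfolding Cck_def by blast
qed

lemma radial_in_Cck:
  assumes "f \<in> Cck_pos k"
  shows "radial f \<in> Cck k \<Omega>"
proof -
  obtain a b where f: "Ck_on k {0<..} f" "0 < a" "\<And>t. 0 < t \<Longrightarrow> t \<notin> {a..b} \<Longrightarrow> f t = 0"
    using assms by (rule Cck_posE) blast
  show ?thesis
    by (rule Cck_mono[OF radial_in_Cck_annulus[OF f] compact_annulus(2)[OF f(2)]])
qed

lemma hintegrable_radial: "f \<in> Cck_pos k \<Longrightarrow> hintegrable (radial f)"
  using hintegrable_Cck_mult[OF radial_in_Cck Omega_subset continuous_on_const, of f k 1] by simp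

lemma grad_radial:
  assumes "x \<in> \<Omega>" "(f has_real_derivative f') (at (r x))"
  shows "grad (radial f) x = f' *\<^sub>R grad r x"
  by (rule grad_eqI, rule GDERIV_transform_within_open[OF GDERIV_radial[OF assms] open_Omega assms(1)])
    (simp add: radial_def)

definition polar_integral :: "(real \<Rightarrow> real) \<Rightarrow> real" where
  "polar_integral f = integral {0<..} (\<lambda>t. f t * sinh t ^ (CARD('n) - 1))"

lemma mult_sinh_power_in_Cck_pos:
  "f \<in> Cck_pos k \<Longrightarrow> (\<lambda>t. f t * sinh t ^ (CARD('n) - 1)) \<in> Cck_pos k"
  by (intro Cck_pos_mult Ck_on_power Ck_on_sinh_cosh)

text \<open>No change of variables is needed: integration by parts against the divergence free field
  \<open>\<nabla>r / sinh r ^ (N - 1)\<close> shows that both sides of the polar formula vanish together.\<close>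

lemma hint_radial_eq_0:
  assumes f: "f \<in> Cck_pos 0" and mean: "polar_integral f = 0"
  shows "hint (radial f) = 0"
proof -
  define d where "d = real CARD('n)"
  obtain P where P: "P \<in> Cck_pos 1"
      "\<And>t. 0 < t \<Longrightarrow> (P has_real_derivative f t * sinh t ^ (CARD('n) - 1)) (at t)"
    using Cck_pos_primitive[OF mult_sinh_power_in_Cck_pos[OF f]] mean
    unfolding polar_integral_def One_nat_def by metis
  note w = radial_in_Cck[OF P(1)]
  define H where "H t = sinh t powr (1 - d)" for t :: real
  have H': "(H has_real_derivative (1 - d) * (cosh t / sinh t) * H t) (at t)" if "0 < t" for t
    unfolding H_def[abs_def] using that
    by (intro has_real_derivative_powr_logder) (auto intro!: derivative_eq_intros)
  have H'_cont: "continuous_on {0<..} (\<lambda>t. (1 - d) * (cosh t / sinh t) * H t)"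
    unfolding H_def[abs_def] by (auto intro!: continuous_intros)
  have "H (r x) * hgrad_inner (radial P) r x
      + radial P x * ((1 - d) * (cosh (r x) / sinh (r x)) * H (r x)
        + (d - 1) * (cosh (r x) / sinh (r x)) * H (r x)) = radial f x" for x
  proof (cases "x \<in> \<Omega>")
    case True
    have "H (r x) * (f (r x) * sinh (r x) ^ (CARD('n) - 1)) = f (r x)"
      using sinh_r_pos[OF True] by (simp add: H_def d_def powr_one_minus_of_nat)
    moreover have "hgrad_inner (radial P) r x = f (r x) * sinh (r x) ^ (CARD('n) - 1) * hgrad_inner r r x"
      by (simp add: hgrad_inner_def grad_radial[OF True P(2)[OF r_pos[OF True]]])
    moreover have "(1 - d) * (cosh (r x) / sinh (r x)) * H (r x)
        + (d - 1) * (cosh (r x) / sinh (r x)) * H (r x) = 0"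
      by (simp add: algebra_simps diff_divide_distrib)
    ultimately show ?thesis
      using True by (simp only: eikonal radial_def mult_1_right mult_zero_right add_0_right if_True)
  next
    case False
    then show ?thesis by (simp add: radial_def hgrad_inner_def grad_Cck_eq_0[OF w])
  qed
  then show ?thesis
    using hint_radial_by_parts(2)[OF w H' H'_cont] by (simp add: d_def)
qed

lemma hint_radial_proportional:
  assumes f: "f \<in> Cck_pos 0" and g: "g \<in> Cck_pos 0"
  shows "polar_integral g * hint (radial f) = polar_integral f * hint (radial g)"
proof -
  define h where "h t = f t * polar_integral g - g t * polar_integral f" for t
  have h: "h \<in> Cck_pos 0"
    unfolding h_def[abs_def] by (intro Cck_pos_diff Cck_pos_mult f g Ck_on_const)
  have "polar_integral h = polar_integral f * polar_integral g - polar_integral g * polar_integral f"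
  proof -
    note int = Cck_pos_0_integrable[OF mult_sinh_power_in_Cck_pos]
    have "polar_integral h = integral {0<..} (\<lambda>t. f t * sinh t ^ (CARD('n) - 1) * polar_integral g
        - g t * sinh t ^ (CARD('n) - 1) * polar_integral f)"
      unfolding polar_integral_def[of h] h_def by (simp add: algebra_simps)
    also have "\<dots> = polar_integral f * polar_integral g - polar_integral g * polar_integral f"
      using int[OF f] int[OF g]
      by (simp add: Henstock_Kurzweil_Integration.integral_diff integrable_on_mult_left
          polar_integral_def[of f] polar_integral_def[of g])
    finally show ?thesis .
  qed
  then have "hint (radial h) = 0"
    by (intro hint_radial_eq_0 h) simp
  moreover have "radial h = (\<lambda>x. polar_integral g * radial f x - polar_integral f * radial g x)"
    by (auto simp: radial_def h_def)
  ultimately show ?thesis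
    using hintegrable_radial[OF f] hintegrable_radial[OF g]
    by (simp add: hint_diff hint_cmult hintegrable_cmult)
qed

lemma Omega_nonempty: "\<Omega> \<noteq> {}"
proof
  assume "\<Omega> = {}"
  then have "finite (hball :: (real^'n) set)"
    using finite_subset[of hball "{x0}"] by (auto simp: \<Omega>_def)
  then show False
    using open_hball pole_in_hball finite_imp_not_open by blast
qed

lemma polar_integration_exists:
  "\<exists>\<sigma>>0. \<forall>f\<in>Cck_pos 0. hint (radial f) = \<sigma> * polar_integral f"
proof -
  obtain x1 where x1: "x1 \<in> \<Omega>" using Omega_nonempty by blast
  define g where "g t = max 0 (r x1 / 2 - \<bar>t - r x1\<bar>)" for t
  have half: "0 < r x1 / 2" using r_pos[OF x1] by simp
  have g: "g \<in> Cck_pos 0"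
    by (rule Cck_posI[OF _ half, of _ _ "3 * r x1 / 2"])
      (auto simp: g_def intro!: continuous_intros)
  have hint_g: "0 < hint (radial g)"
  proof (rule hint_pos)
    show "radial g \<in> Cck 0 hball"
      by (rule Cck_mono[OF radial_in_Cck[OF g] Omega_subset])
    show "0 < radial g x1" using x1 half by (simp add: radial_def g_def)
  qed (simp add: radial_def g_def)
  have "0 \<le> polar_integral g"
    unfolding polar_integral_def
    by (rule Henstock_Kurzweil_Integration.integral_nonneg
        [OF Cck_pos_0_integrable[OF mult_sinh_power_in_Cck_pos[OF g]]]) (simp add: g_def)
  moreover have "polar_integral g \<noteq> 0"
    using hint_radial_eq_0[OF g] hint_g by auto
  ultimately have polar_g: "0 < polar_integral g" by simp
  show ?thesis
  proof (intro exI conjI ballI)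
    show "0 < hint (radial g) / polar_integral g"
      using hint_g polar_g by simp
    show "hint (radial f) = hint (radial g) / polar_integral g * polar_integral f" if "f \<in> Cck_pos 0" for f
      using hint_radial_proportional[OF that g] polar_g by (simp add: field_simps)
  qed
qed

definition sphere_area :: real where
  "sphere_area = (SOME \<sigma>. 0 < \<sigma> \<and> (\<forall>f\<in>Cck_pos 0. hint (radial f) = \<sigma> * polar_integral f))"

lemma sphere_area_pos: "0 < sphere_area"
  and hint_radial: "f \<in> Cck_pos 0 \<Longrightarrow> hint (radial f) = sphere_area * polar_integral f"
  using someI_ex[OF polar_integration_exists] unfolding sphere_area_def by blast+

end

subsection \<open>Trial functions\<close>

definition bump :: "real \<Rightarrow> real" where
  "bump s = flat_exp 0 (1 - s\<^sup>2)"

definition dbump :: "real \<Rightarrow> real" where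
  "dbump s = flat_exp 2 (1 - s\<^sup>2) * (- 2 * s)"

lemma bump_has_derivative: "(bump has_real_derivative dbump s) (at s)"
  unfolding bump_def[abs_def] dbump_def
  by (rule DERIV_chain2[OF flat_exp_0_has_derivative]) (auto intro!: derivative_eq_intros)

lemma Ck_on_bump: "Ck_on j UNIV bump"
  unfolding bump_def[abs_def]
  using Ck_on_norm_diff_sq[of j UNIV "0 :: real"]
  by (intro Ck_on_compose[OF UNIV_I Ck_on_flat_exp] Ck_on_diff Ck_on_const) simp

lemma continuous_on_dbump: "continuous_on S dbump"
  unfolding dbump_def[abs_def]
  by (intro continuous_intros
      continuous_on_compose2[OF Ck_on_imp_continuous_on[OF Ck_on_flat_exp[of 0 UNIV 2]]]) auto

lemma bump_eq_0: "1 \<le> \<bar>s\<bar> \<Longrightarrow> bump s = 0" and dbump_eq_0: "1 \<le> \<bar>s\<bar> \<Longrightarrow> dbump s = 0"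
  using abs_le_square_iff[of 1 s] by (auto simp: bump_def dbump_def flat_exp_eq_0)

lemma bump_pos: "\<bar>s\<bar> < 1 \<Longrightarrow> 0 < bump s"
  by (auto simp: bump_def abs_square_less_1 intro!: flat_exp_pos)

lemma bump_nonneg: "0 \<le> bump s"
  by (simp add: bump_def flat_exp_nonneg)

lemma bump_antimono: "\<bar>s\<bar> \<le> \<bar>t\<bar> \<Longrightarrow> bump t \<le> bump s"
  by (auto simp: bump_def abs_le_square_iff intro!: flat_exp_0_mono)

lemma integral_bump_sq_pos: "0 < integral {-1..1} (\<lambda>s. (bump s)\<^sup>2)"
proof -
  have cont: "continuous_on {-1..1} (\<lambda>s. (bump s)\<^sup>2)"
    by (intro continuous_intros continuous_on_subset[OF Ck_on_imp_continuous_on[OF Ck_on_bump]]) simp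
  have "integral {-1..1} (\<lambda>s. (bump s)\<^sup>2) \<noteq> 0"
    using integral_eq_0_iff[OF cont] bump_pos[of 0] by force
  moreover have "0 \<le> integral {-1..1} (\<lambda>s. (bump s)\<^sup>2)"
    using cont by (intro Henstock_Kurzweil_Integration.integral_nonneg integrable_continuous_real) auto
  ultimately show ?thesis by simp
qed

definition log_profile :: "(real \<Rightarrow> real) \<Rightarrow> real \<Rightarrow> real \<Rightarrow> real \<Rightarrow> real" where
  "log_profile \<beta> T k t = \<beta> ((ln t - T) / k)"

lemma log_profile_eq_0:
  assumes "\<And>s. 1 \<le> \<bar>s\<bar> \<Longrightarrow> \<beta> s = 0" "0 < k" "0 < t" "t \<notin> {exp (T - k)..exp (T + k)}"
  shows "log_profile \<beta> T k t = 0"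
proof -
  have "ln t < T - k \<or> T + k < ln t"
    using assms(3,4) by (metis atLeastAtMost_iff exp_le_cancel_iff exp_ln linorder_not_le)
  then have "1 \<le> \<bar>(ln t - T) / k\<bar>"
    using assms(2) by (auto simp: abs_if field_simps)
  then show ?thesis by (simp add: log_profile_def assms(1))
qed

lemma Ck_on_log_profile:
  assumes "Ck_on j UNIV \<beta>"
  shows "Ck_on j {0<..} (log_profile \<beta> T k)"
proof -
  have "Ck_on j {0<..} (\<lambda>t. (ln t - T) / k)"
    unfolding divide_inverse by (intro Ck_on_mult Ck_on_diff Ck_on_ln Ck_on_const)
  from Ck_on_compose[OF UNIV_I assms this] show ?thesis
    by (simp add: log_profile_def[abs_def])
qed

lemma log_profile_in_Cck_pos:
  assumes "Ck_on j UNIV \<beta>" "\<And>s. 1 \<le> \<bar>s\<bar> \<Longrightarrow> \<beta> s = 0" "0 < k"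
  shows "log_profile \<beta> T k \<in> Cck_pos j"
  by (rule Cck_posI[OF Ck_on_log_profile[OF assms(1)] exp_gt_zero log_profile_eq_0[OF assms(2,3)]])

lemma log_profile_has_derivative:
  assumes "(\<beta> has_real_derivative \<beta>') (at ((ln t - T) / k))" "0 < k" "0 < t"
  shows "(log_profile \<beta> T k has_real_derivative \<beta>' / (k * t)) (at t)"
proof -
  have "((\<lambda>t. (ln t - T) / k) has_real_derivative 1 / (k * t)) (at t)"
    using assms(2,3) by (auto intro!: derivative_eq_intros simp: field_simps)
  from DERIV_chain2[OF assms(1) this] show ?thesis
    unfolding log_profile_def[abs_def] by simp
qed

lemma integral_log_profile:
  assumes \<beta>: "continuous_on UNIV \<beta>" "\<And>s. 1 \<le> \<bar>s\<bar> \<Longrightarrow> \<beta> s = 0" and k: "0 < k"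
  shows "integral {0<..} (\<lambda>t. log_profile \<beta> T k t / t) = k * integral {-1..1} \<beta>"
proof -
  define f where "f t = log_profile \<beta> T k t / t" for t
  define e where "e s = exp (T + k * s)" for s
  have "((\<lambda>s. (k * e s) *\<^sub>R f (e s)) has_integral integral {e (-1)..e 1} f) {-1..1}"
  proof (rule has_integral_substitution)
    show "continuous_on {e (-1)..e 1} f"
      unfolding f_def log_profile_def e_def
      by (intro continuous_intros continuous_on_compose2[OF \<beta>(1)])
        (use k in \<open>auto dest: less_le_trans[OF exp_gt_zero]\<close>)
    show "e ` {-1..1} \<subseteq> {e (-1)..e 1}"
      using mult_left_mono[of "- 1" _ k] mult_left_mono[of _ 1 k] k by (auto simp: e_def)
    show "(e has_real_derivative k * e s) (at s within {-1..1})" for s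
      unfolding e_def[abs_def] by (auto intro!: derivative_eq_intros)
  qed (use k in \<open>auto simp: e_def\<close>)
  moreover have "(k * e s) *\<^sub>R f (e s) = k * \<beta> s" for s
    using k by (simp add: f_def e_def log_profile_def)
  ultimately have "((\<lambda>s. k * \<beta> s) has_integral integral {e (-1)..e 1} f) {-1..1}"
    by (simp only:)
  then have "integral {-1..1} (\<lambda>s. k * \<beta> s) = integral {e (-1)..e 1} f"
    by (rule integral_unique)
  moreover have "integral {0<..} f = integral {e (-1)..e 1} f"
  proof (rule integral_eq_integral_support)
    show "{e (-1)..e 1} \<subseteq> {0<..}"
      by (auto simp: e_def dest: less_le_trans[OF exp_gt_zero])
    show "f t = 0" if "t \<in> {0<..} - {e (-1)..e 1}" for t
      using that by (simp add: f_def e_def log_profile_eq_0[OF \<beta>(2) k])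
  qed
  ultimately show ?thesis by (simp add: f_def[abs_def])
qed

context hyperbolic_pole
begin

definition trial :: "real \<Rightarrow> real \<Rightarrow> real^'n \<Rightarrow> real" where
  "trial T k = radial (\<lambda>t. log_profile bump T k t * ground (real CARD('n)) t)"

lemma trial_profile_eq_0:
  "0 < k \<Longrightarrow> 0 < t \<Longrightarrow> t \<notin> {exp (T - k)..exp (T + k)} \<Longrightarrow> log_profile bump T k t * ground d t = 0"
  by (simp add: log_profile_eq_0 bump_eq_0)

lemma trial_in_test_funs:
  assumes "0 < k" "annulus (exp (T - k)) (exp (T + k)) \<subseteq> U"
  shows "trial T k \<in> test_funs U"
proof -
  have "Ck_on j {0<..} (\<lambda>t. log_profile bump T k t * ground (real CARD('n)) t)" for j
    by (intro Ck_on_mult Ck_on_log_profile Ck_on_bump Ck_on_ground)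
  from radial_in_Cck_annulus[OF this exp_gt_zero trial_profile_eq_0[OF assms(1)]] show ?thesis
    unfolding test_funs_iff_Cck trial_def using assms(2) by (blast intro: Cck_mono)
qed

lemma trial_in_test_funs_Omega: "0 < k \<Longrightarrow> trial T k \<in> test_funs \<Omega>"
  by (intro trial_in_test_funs compact_annulus(2)) auto

lemma trial_in_Cck_Omega: "0 < k \<Longrightarrow> trial T k \<in> Cck j \<Omega>"
  using trial_in_test_funs_Omega test_funs_iff_Cck by blast

lemma trial_sq_eq:
  "(trial T k x)\<^sup>2 = radial (\<lambda>t. log_profile (\<lambda>s. (bump s)\<^sup>2) T k t * (t / sinh t ^ (CARD('n) - 1))) x"
  by (simp add: trial_def radial_def log_profile_def power_mult_distrib ground_sq r_pos)

lemma ground_state_energy_trial: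
  assumes k: "0 < k"
  shows "ground_state_energy (trial T k) x
    = radial (\<lambda>t. log_profile (\<lambda>s. (dbump s)\<^sup>2 / k\<^sup>2) T k t / t / sinh t ^ (CARD('n) - 1)) x"
proof (cases "x \<in> \<Omega>")
  case True
  define t where "t = r x"
  define d where "d = real CARD('n)"
  have t: "0 < t" "0 < sinh t" using r_pos[OF True] by (simp_all add: t_def)
  define e where "e = dbump ((ln t - T) / k) / (k * t) * ground d t"
  have "((\<lambda>t. log_profile bump T k t * ground d t) has_real_derivative
      e + ground_logder d t * ground d t * log_profile bump T k t) (at t)"
    unfolding e_def
    by (rule DERIV_mult[OF log_profile_has_derivative[OF bump_has_derivative k t(1)]
          ground_has_derivative[OF t(1)]])
  from grad_radial[OF True this[unfolded t_def]]
  have "grad (trial T k) x = (e + ground_logder d t * trial T k x) *\<^sub>R grad r x"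
    using True by (simp add: trial_def radial_def d_def t_def mult_ac)
  then have "grad (trial T k) x - (ground_logder d t * trial T k x) *\<^sub>R grad r x = e *\<^sub>R grad r x"
    by (simp add: scaleR_add_left)
  then have "ground_state_energy (trial T k) x = e\<^sup>2 * hgrad_inner r r x"
    unfolding ground_state_energy_def t_def[symmetric] d_def[symmetric] hgrad_inner_def
      power2_norm_eq_inner[symmetric]
    by (simp add: power_mult_distrib power_divide)
  also have "\<dots> = (dbump ((ln t - T) / k) / (k * t))\<^sup>2 * (t / sinh t ^ (CARD('n) - 1))"
    by (simp only: eikonal[OF True] e_def power_mult_distrib d_def
        ground_sq[OF t(1) zero_less_card_finite] mult_1_right)
  finally show ?thesis
    using True t by (simp add: radial_def log_profile_def t_def[symmetric] power2_eq_square field_simps)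
next
  case False
  then show ?thesis
    by (simp add: ground_state_energy_Cck_eq_0[OF trial_in_Cck_Omega[OF k]] radial_def)
qed

lemma hint_log_profile:
  assumes \<beta>: "continuous_on UNIV \<beta>" "\<And>s. 1 \<le> \<bar>s\<bar> \<Longrightarrow> \<beta> s = 0" and k: "0 < k"
  shows "hint (radial (\<lambda>t. log_profile \<beta> T k t / t / sinh t ^ (CARD('n) - 1)))
    = sphere_area * (k * integral {-1..1} \<beta>)"
proof -
  have "log_profile \<beta> T k \<in> Cck_pos 0"
    using \<beta> k by (intro log_profile_in_Cck_pos) auto
  moreover have "Ck_on 0 {0<..} (\<lambda>t. 1 / t / sinh t ^ (CARD('n) - 1))"
    by (auto intro!: continuous_intros)
  ultimately have "(\<lambda>t. log_profile \<beta> T k t * (1 / t / sinh t ^ (CARD('n) - 1))) \<in> Cck_pos 0"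
    by (rule Cck_pos_mult)
  then have "hint (radial (\<lambda>t. log_profile \<beta> T k t / t / sinh t ^ (CARD('n) - 1)))
      = sphere_area * polar_integral (\<lambda>t. log_profile \<beta> T k t / t / sinh t ^ (CARD('n) - 1))"
    by (intro hint_radial) simp
  also have "polar_integral (\<lambda>t. log_profile \<beta> T k t / t / sinh t ^ (CARD('n) - 1))
      = integral {0<..} (\<lambda>t. log_profile \<beta> T k t / t)"
    unfolding polar_integral_def by (intro Henstock_Kurzweil_Integration.integral_cong) auto
  finally show ?thesis by (simp add: integral_log_profile[OF \<beta> k])
qed

definition bump_mass :: real where
  "bump_mass = sphere_area * integral {-1..1} (\<lambda>s. (bump s)\<^sup>2)"

definition dbump_mass :: real where
  "dbump_mass = sphere_area * integral {-1..1} (\<lambda>s. (dbump s)\<^sup>2)"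

lemma bump_mass_pos: "0 < bump_mass"
  using sphere_area_pos integral_bump_sq_pos by (simp add: bump_mass_def)

lemma hint_trial_sq_div_r_sq:
  assumes "0 < k"
  shows "hint (\<lambda>x. (trial T k x)\<^sup>2 / (r x)\<^sup>2) = bump_mass * k"
proof -
  have "(\<lambda>x. (trial T k x)\<^sup>2 / (r x)\<^sup>2)
      = radial (\<lambda>t. log_profile (\<lambda>s. (bump s)\<^sup>2) T k t / t / sinh t ^ (CARD('n) - 1))"
    unfolding trial_sq_eq by (auto simp: radial_def fun_eq_iff power2_eq_square dest: r_pos)
  moreover have "continuous_on UNIV (\<lambda>s. (bump s)\<^sup>2)"
    by (intro continuous_intros Ck_on_imp_continuous_on[OF Ck_on_bump])
  ultimately show ?thesis
    using hint_log_profile[of "\<lambda>s. (bump s)\<^sup>2" k T] assms by (simp add: bump_eq_0 bump_mass_def mult_ac)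
qed

lemma hint_hgrad_sq_trial:
  assumes k: "0 < k"
  shows "hint (hgrad_sq (trial T k)) - hint (\<lambda>x. pot x * (trial T k x)\<^sup>2)
    = dbump_mass / k"
proof -
  have "continuous_on UNIV (\<lambda>s. (dbump s)\<^sup>2 / k\<^sup>2)"
    using k by (intro continuous_intros continuous_on_dbump) simp
  then have "hint (ground_state_energy (trial T k))
      = sphere_area * (k * integral {-1..1} (\<lambda>s. (dbump s)\<^sup>2 / k\<^sup>2))"
    unfolding ground_state_energy_trial[OF k, abs_def]
    by (rule hint_log_profile) (simp_all add: dbump_eq_0 k)
  then show ?thesis
    using ground_state_representation[OF trial_in_Cck_Omega[OF k]] k
    by (simp add: dbump_mass_def power2_eq_square)
qed

end

subsection \<open>Optimality and criticality\<close>

lemma AE_eq_0_of_incseq_nn_integral: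
  fixes f :: "nat \<Rightarrow> 'a \<Rightarrow> ennreal"
  assumes meas: "\<And>n. f n \<in> borel_measurable M" and mono: "incseq f"
    and lim: "(\<lambda>n. \<integral>\<^sup>+ x. f n x \<partial>M) \<longlonglongrightarrow> 0"
  shows "AE x in M. \<forall>n. f n x = 0"
proof -
  have "incseq (\<lambda>n. \<integral>\<^sup>+ x. f n x \<partial>M)"
    using mono by (auto simp: incseq_def le_fun_def intro!: nn_integral_mono)
  then have "(\<integral>\<^sup>+ x. f n x \<partial>M) \<le> 0" for n
    using lim by (rule incseq_le)
  then have "AE x in M. f n x = 0" for n
    using nn_integral_0_iff_AE[OF meas] by simp
  then show ?thesis by (simp add: AE_all_countable)
qed

context hyperbolic_pole
begin

lemma hintegrable_radial_weight:
  assumes "u \<in> Cck k \<Omega>" "continuous_on {0<..} p"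
  shows "hintegrable (\<lambda>x. p (r x) * (u x)\<^sup>2)"
proof -
  have "(\<lambda>x. (u x)\<^sup>2) \<in> Cck k \<Omega>"
    unfolding power2_eq_square by (rule Cck_mult[OF open_Omega assms(1) Cck_Ck_on[OF assms(1)]])
  from hintegrable_Cck_mult[OF this Omega_subset continuous_on_radial[OF assms(2)]] show ?thesis .
qed

lemma hint_three_term_weight_Omega:
  assumes "u \<in> Cck k \<Omega>"
  shows "hint (\<lambda>x. (\<alpha> + \<beta> / (r x)\<^sup>2 + \<gamma> / (sinh (r x))\<^sup>2) * (u x)\<^sup>2)
    = \<alpha> * hint (\<lambda>x. (u x)\<^sup>2) + \<beta> * hint (\<lambda>x. (u x)\<^sup>2 / (r x)\<^sup>2)
      + \<gamma> * hint (\<lambda>x. (u x)\<^sup>2 / (sinh (r x))\<^sup>2)"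
proof (rule hint_three_term_weight)
  show "hintegrable (\<lambda>x. \<alpha> * (u x)\<^sup>2)"
    by (rule hintegrable_radial_weight[OF assms, of "\<lambda>t. \<alpha>"]) (intro continuous_intros)
  have "continuous_on {0<..} (\<lambda>t::real. \<beta> / t\<^sup>2)" "continuous_on {0<..} (\<lambda>t. \<gamma> / (sinh t)\<^sup>2)"
    by (auto intro!: continuous_intros)
  from this[THEN hintegrable_radial_weight[OF assms]]
  show "hintegrable (\<lambda>x. \<beta> * ((u x)\<^sup>2 / (r x)\<^sup>2))" "hintegrable (\<lambda>x. \<gamma> * ((u x)\<^sup>2 / (sinh (r x))\<^sup>2))"
    by simp_all
qed

lemma hint_hgrad_sq_trial_less:
  assumes k: "0 < k" "dbump_mass / k < \<delta> * (bump_mass * k)" and p: "continuous_on {0<..} p"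
    and le: "\<And>t. t \<in> {exp (T - k)..exp (T + k)} \<Longrightarrow> hardy_pot (real CARD('n)) t + \<delta> / t\<^sup>2 \<le> p t"
  shows "hint (hgrad_sq (trial T k)) < hint (\<lambda>x. p (r x) * (trial T k x)\<^sup>2)"
proof -
  define u where "u = trial T k"
  have support: "u x = 0 \<or> x \<in> hball \<and> r x \<in> {exp (T - k)..exp (T + k)}" for x
    using trial_profile_eq_0[OF k(1) r_pos] Omega_subset by (auto simp: u_def trial_def radial_def)
  have inverse_square: "continuous_on {0<..} (\<lambda>t. \<delta> / t\<^sup>2)"
    by (auto intro!: continuous_intros)
  note int = hintegrable_radial_weight[OF trial_in_Cck_Omega[OF k(1), where T = T and j = 0], folded u_def]
  have "hint (hgrad_sq u) = hint (\<lambda>x. pot x * (u x)\<^sup>2) + dbump_mass / k"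
    using hint_hgrad_sq_trial[OF k(1), of T] by (simp add: u_def)
  also have "dbump_mass / k < hint (\<lambda>x. \<delta> / (r x)\<^sup>2 * (u x)\<^sup>2)"
    using k(2) hint_trial_sq_div_r_sq[OF k(1), of T] hint_cmult[of \<delta> "\<lambda>x. (u x)\<^sup>2 / (r x)\<^sup>2"]
    by (simp add: u_def)
  also have "hint (\<lambda>x. pot x * (u x)\<^sup>2) + hint (\<lambda>x. \<delta> / (r x)\<^sup>2 * (u x)\<^sup>2)
      = hint (\<lambda>x. pot x * (u x)\<^sup>2 + \<delta> / (r x)\<^sup>2 * (u x)\<^sup>2)"
    by (rule hint_add[symmetric, OF int[OF continuous_on_hardy_pot] int[OF inverse_square]])
  also have "\<dots> \<le> hint (\<lambda>x. p (r x) * (u x)\<^sup>2)"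
  proof (rule hint_mono[OF hintegrable_add[OF int[OF continuous_on_hardy_pot] int[OF inverse_square]]
        int[OF p]])
    show "pot x * (u x)\<^sup>2 + \<delta> / (r x)\<^sup>2 * (u x)\<^sup>2 \<le> p (r x) * (u x)\<^sup>2" for x
      using support[of x] mult_right_mono[OF le[of "r x"], of "(u x)\<^sup>2"] by (auto simp: distrib_right)
  qed (use support in force)
  finally show ?thesis by (simp add: u_def)
qed

lemma hardy_inequality_not_improvable:
  assumes \<delta>: "0 < \<delta>"
    and improved: "\<forall>\<^sub>F k in at_top. annulus (exp (T k - k)) (exp (T k + k)) \<subseteq> U \<and>
      (\<forall>t\<in>{exp (T k - k)..exp (T k + k)}.
        hardy_pot (real CARD('n)) t + \<delta> / t\<^sup>2 \<le> \<alpha> + \<beta> / t\<^sup>2 + \<gamma> / (sinh t)\<^sup>2)"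
  shows "\<exists>u\<in>test_funs U. hint (hgrad_sq u) < \<alpha> * hint (\<lambda>x. (u x)\<^sup>2) + \<beta> * hint (\<lambda>x. (u x)\<^sup>2 / (r x)\<^sup>2)
    + \<gamma> * hint (\<lambda>x. (u x)\<^sup>2 / (sinh (r x))\<^sup>2)"
proof -
  have "0 < \<delta> * bump_mass" using \<delta> bump_mass_pos by simp
  then have "\<forall>\<^sub>F k in at_top. dbump_mass / k < \<delta> * bump_mass * k" by real_asymp
  from eventually_happens'[OF _ eventually_conj[OF eventually_gt_at_top[of 0]
        eventually_conj[OF this improved]]]
  obtain k where k: "0 < k" "dbump_mass / k < \<delta> * (bump_mass * k)"
    and U: "annulus (exp (T k - k)) (exp (T k + k)) \<subseteq> U"
    and le: "\<And>t. t \<in> {exp (T k - k)..exp (T k + k)} \<Longrightarrow>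
      hardy_pot (real CARD('n)) t + \<delta> / t\<^sup>2 \<le> \<alpha> + \<beta> / t\<^sup>2 + \<gamma> / (sinh t)\<^sup>2"
    by (auto simp: mult.assoc)
  have "continuous_on {0<..} (\<lambda>t. \<alpha> + \<beta> / t\<^sup>2 + \<gamma> / (sinh t)\<^sup>2)"
    by (auto intro!: continuous_intros)
  from hint_hgrad_sq_trial_less[OF k this le] show ?thesis
    unfolding hint_three_term_weight_Omega[OF trial_in_Cck_Omega[OF k(1)]]
    using trial_in_test_funs[OF k(1) U] by (intro bexI[of _ "trial (T k) k"]) simp_all
qed

theorem hardy_constant_optimal:
  assumes c: "1 / 4 < c"
  defines "d \<equiv> real CARD('n)"
  shows "\<exists>u\<in>test_funs hball. hint (hgrad_sq u) - (d - 1)\<^sup>2 / 4 * hint (\<lambda>x. (u x)\<^sup>2)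
    < c * hint (\<lambda>x. (u x)\<^sup>2 / (r x)\<^sup>2)"
proof -
  define \<kappa> where "\<kappa> = (d - 1) * (d - 3) / 4"
  define \<delta> where "\<delta> = (c - 1 / 4) / 2"
  have \<delta>: "0 < \<delta>" using c by (simp add: \<delta>_def)
  have "((\<lambda>t. \<kappa> * (t\<^sup>2 / (sinh t)\<^sup>2)) \<longlongrightarrow> \<kappa> * 0) at_top"
    by (intro tendsto_mult tendsto_const) real_asymp
  then have "\<forall>\<^sub>F t in at_top. \<kappa> * (t\<^sup>2 / (sinh t)\<^sup>2) < \<delta>"
    using \<delta> by (intro order_tendstoD(2)) auto
  then obtain M where M: "\<And>t. M \<le> t \<Longrightarrow> \<kappa> * (t\<^sup>2 / (sinh t)\<^sup>2) < \<delta>"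
    by (auto simp: eventually_at_top_linorder)
  have improved: "hardy_pot d t + \<delta> / t\<^sup>2 \<le> (d - 1)\<^sup>2 / 4 + c / t\<^sup>2 + 0 / (sinh t)\<^sup>2"
    if "0 < t" "M \<le> t" for t
  proof -
    have "\<kappa> / (sinh t)\<^sup>2 \<le> \<delta> / t\<^sup>2"
      using M[OF that(2)] that(1) by (simp add: field_simps)
    moreover have "c = 1 / 4 + \<delta> + \<delta>" by (simp add: \<delta>_def field_simps)
    then have "c / t\<^sup>2 = 1 / 4 / t\<^sup>2 + \<delta> / t\<^sup>2 + \<delta> / t\<^sup>2" by (simp only: add_divide_distrib)
    ultimately show ?thesis by (simp add: hardy_pot_def flip: \<kappa>_def)
  qed
  have "\<forall>\<^sub>F k in at_top. annulus (exp (2 * k - k)) (exp (2 * k + k)) \<subseteq> hball \<and>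
      (\<forall>t\<in>{exp (2 * k - k)..exp (2 * k + k)}.
        hardy_pot d t + \<delta> / t\<^sup>2 \<le> (d - 1)\<^sup>2 / 4 + c / t\<^sup>2 + 0 / (sinh t)\<^sup>2)"
    using filterlim_at_top[THEN iffD1, OF exp_at_top, rule_format, of M]
  proof eventually_elim
    case (elim k)
    then show ?case
      using improved less_le_trans[OF exp_gt_zero, of k] order_trans[OF elim] by auto
  qed
  from hardy_inequality_not_improvable[OF \<delta> this[unfolded d_def]] show ?thesis
    by (force simp: d_def)
qed

theorem sinh_constant_optimal:
  assumes \<epsilon>: "0 < \<epsilon>" and c: "(real CARD('n) - 1) * (real CARD('n) - 3) / 4 < c"
  defines "d \<equiv> real CARD('n)"
  shows "\<exists>u\<in>test_funs {x\<in>hball. r x < \<epsilon>}. hint (hgrad_sq u) - (d - 1)\<^sup>2 / 4 * hint (\<lambda>x. (u x)\<^sup>2)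
    < 1 / 4 * hint (\<lambda>x. (u x)\<^sup>2 / (r x)\<^sup>2) + c * hint (\<lambda>x. (u x)\<^sup>2 / (sinh (r x))\<^sup>2)"
proof -
  define \<kappa> where "\<kappa> = (d - 1) * (d - 3) / 4"
  define \<delta> where "\<delta> = (c - \<kappa>) / 2"
  have \<delta>: "0 < \<delta>" using c by (simp add: \<delta>_def \<kappa>_def d_def)
  have "((\<lambda>t::real. t\<^sup>2 / (sinh t)\<^sup>2) \<longlongrightarrow> 1) (at_right 0)" by real_asymp
  then have "\<forall>\<^sub>F t::real in at_right 0. 1 / 2 < t\<^sup>2 / (sinh t)\<^sup>2"
    by (rule order_tendstoD(1)) simp
  then obtain M where M: "0 < M" "\<And>t::real. 0 < t \<Longrightarrow> t < M \<Longrightarrow> 1 / 2 < t\<^sup>2 / (sinh t)\<^sup>2"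
    by (auto simp: eventually_at_right_field)
  have improved: "hardy_pot d t + \<delta> / t\<^sup>2 \<le> (d - 1)\<^sup>2 / 4 + 1 / 4 / t\<^sup>2 + c / (sinh t)\<^sup>2"
    if "0 < t" "t < M" for t
  proof -
    have "1 / t\<^sup>2 \<le> 2 / (sinh t)\<^sup>2"
      using M(2)[OF that] that(1) by (simp add: field_simps)
    then have "\<delta> / t\<^sup>2 \<le> 2 * \<delta> / (sinh t)\<^sup>2"
      using \<delta> mult_left_mono[of "1 / t\<^sup>2" "2 / (sinh t)\<^sup>2" \<delta>] by (simp add: mult.commute)
    moreover have "c = \<kappa> + 2 * \<delta>" by (simp add: \<delta>_def field_simps)
    then have "c / (sinh t)\<^sup>2 = \<kappa> / (sinh t)\<^sup>2 + 2 * \<delta> / (sinh t)\<^sup>2" by (simp only: add_divide_distrib)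
    ultimately show ?thesis by (simp add: hardy_pot_def flip: \<kappa>_def)
  qed
  have "((\<lambda>k::real. exp (- k)) \<longlongrightarrow> 0) at_top" by real_asymp
  then have "\<forall>\<^sub>F k::real in at_top. exp (- k) < min M \<epsilon>"
    using M(1) \<epsilon> by (intro order_tendstoD(2)) auto
  then have "\<forall>\<^sub>F k in at_top. annulus (exp (- 2 * k - k)) (exp (- 2 * k + k)) \<subseteq> {x\<in>hball. r x < \<epsilon>} \<and>
      (\<forall>t\<in>{exp (- 2 * k - k)..exp (- 2 * k + k)}.
        hardy_pot d t + \<delta> / t\<^sup>2 \<le> (d - 1)\<^sup>2 / 4 + 1 / 4 / t\<^sup>2 + c / (sinh t)\<^sup>2)"
  proof eventually_elim
    case (elim k)
    then show ?case
      using improved less_le_trans[OF exp_gt_zero, of "- (3 * k)"] by auto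
  qed
  from hardy_inequality_not_improvable[OF \<delta> this[unfolded d_def]] show ?thesis
    by (force simp: d_def)
qed

lemma trial_nonneg: "0 \<le> trial T k x"
  by (simp add: trial_def radial_def log_profile_def bump_nonneg ground_pos r_pos less_imp_le)

lemma trial_0_mono:
  assumes "0 < k" "k \<le> l"
  shows "trial 0 k x \<le> trial 0 l x"
proof (cases "x \<in> \<Omega>")
  case True
  have "\<bar>ln (r x) / l\<bar> \<le> \<bar>ln (r x) / k\<bar>"
    using assms unfolding abs_divide by (intro divide_left_mono) auto
  then show ?thesis
    using True by (simp add: trial_def radial_def log_profile_def bump_antimono mult_right_mono
        ground_pos r_pos less_imp_le)
qed (simp add: trial_def radial_def)

lemma trial_0_eventually_pos:
  assumes "x \<in> \<Omega>"
  obtains n where "0 < trial 0 (real (Suc n)) x"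
proof -
  obtain n where "\<bar>ln (r x)\<bar> < real n" using reals_Archimedean2 by blast
  then have "\<bar>ln (r x) / real (Suc n)\<bar> < 1" by (simp add: abs_divide)
  with assms show ?thesis
    by (intro that[of n]) (simp add: trial_def radial_def log_profile_def bump_pos ground_pos r_pos)
qed

lemma borel_measurable_trial: "0 < k \<Longrightarrow> trial T k \<in> borel_measurable borel"
  by (rule borel_measurable_continuous_onI[OF Cck_continuous_on[OF trial_in_Cck_Omega]])

lemma improving_weight_AE_zero:
  assumes W: "W \<in> borel_measurable lborel" "\<And>x. x \<in> \<Omega> \<Longrightarrow> 0 \<le> W x"
    and improved: "\<And>u. u \<in> test_funs \<Omega> \<Longrightarrow> (\<integral>\<^sup>+ x. ennreal (W x * (u x)\<^sup>2 * hdens x) \<partial>lborel)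
      \<le> ennreal (hQ pot u)"
  shows "AE x in lborel. x \<in> \<Omega> \<longrightarrow> W x = 0"
proof -
  define f where "f n x = ennreal (W x * (trial 0 (real (Suc n)) x)\<^sup>2 * hdens x)" for n x
  have "f n \<in> borel_measurable lborel" for n
  proof -
    have "(\<lambda>x. W x * (trial 0 (real (Suc n)) x)\<^sup>2 * hdens x) \<in> borel_measurable lborel"
      using W(1) borel_measurable_hdens borel_measurable_trial[of "real (Suc n)" 0]
      by (intro borel_measurable_times borel_measurable_power) simp_all
    then show ?thesis unfolding f_def by simp
  qed
  moreover have "incseq f"
  proof (intro incseq_SucI le_funI)
    show "f n x \<le> f (Suc n) x" for n x
    proof (cases "x \<in> \<Omega>")
      case True
      then show ?thesis
        unfolding f_def using W(2)[OF True] hdens_pos[of x] Omega_subset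
        by (intro ennreal_leI mult_right_mono mult_left_mono power_mono trial_0_mono trial_nonneg) auto
    qed (simp add: f_def trial_def radial_def)
  qed
  moreover have "(\<lambda>n. \<integral>\<^sup>+ x. f n x \<partial>lborel) \<longlonglongrightarrow> 0"
  proof (rule tendsto_sandwich[OF _ _ tendsto_const])
    show "\<forall>\<^sub>F n in sequentially. (\<integral>\<^sup>+ x. f n x \<partial>lborel) \<le> ennreal (dbump_mass / real (Suc n))"
      using improved[OF trial_in_test_funs_Omega] hint_hgrad_sq_trial
      by (simp add: f_def hQ_def del: of_nat_Suc)
    have "(\<lambda>n. dbump_mass / real (Suc n)) \<longlonglongrightarrow> 0" by real_asymp
    then show "(\<lambda>n. ennreal (dbump_mass / real (Suc n))) \<longlonglongrightarrow> 0"
      using tendsto_ennrealI by fastforce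
  qed simp
  ultimately have "AE x in lborel. \<forall>n. f n x = 0"
    by (rule AE_eq_0_of_incseq_nn_integral)
  then show ?thesis
  proof (eventually_elim, intro impI)
    fix x assume f_eq_0: "\<forall>n. f n x = 0" and x: "x \<in> \<Omega>"
    obtain n where "0 < trial 0 (real (Suc n)) x" using trial_0_eventually_pos[OF x] .
    moreover have "0 < hdens x" using x hdens_pos Omega_subset by blast
    ultimately have "0 < (trial 0 (real (Suc n)) x)\<^sup>2 * hdens x" by simp
    moreover have "W x * ((trial 0 (real (Suc n)) x)\<^sup>2 * hdens x) \<le> 0"
      using f_eq_0 by (simp add: f_def ennreal_eq_0_iff mult.assoc)
    ultimately have "W x \<le> 0"
      by (meson linorder_not_le mult_pos_pos)
    with W(2)[OF x] show "W x = 0" by simp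
  qed
qed

theorem hardy_operator_critical: "critical \<Omega> pot"
proof -
  have "0 \<le> hQ pot u" if "u \<in> test_funs \<Omega>" for u
  proof -
    have u: "u \<in> Cck 1 \<Omega>" using that by (simp add: test_funs_iff_Cck)
    have "0 \<le> hint (ground_state_energy u)"
      by (intro hint_nonneg ground_state_energy_nonneg
        ground_state_energy_Cck_eq_0[OF Cck_mono[OF u Omega_subset]])
    then show ?thesis
      using ground_state_representation[OF u] by (simp add: hQ_def)
  qed
  then show ?thesis
    unfolding critical_def using improving_weight_AE_zero by blast
qed

end

theorem theorem2p1:
  fixes x0 :: "real^'n"
  assumes N3: "CARD('n) \<ge> 3"
    and o_in: "x0 \<in> hball"
  defines "N \<equiv> real CARD('n)"
  defines "r \<equiv> (\<lambda>x. hdist x x0)"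
  shows
    "(\<forall>u\<in>test_funs hball.
        hint (hgrad_sq u) - (N - 1)^2 / 4 * hint (\<lambda>x. (u x)^2)
          \<ge> 1/4 * hint (\<lambda>x. (u x)^2 / (r x)^2)
            + (N - 1) * (N - 3) / 4 * hint (\<lambda>x. (u x)^2 / (sinh (r x))^2))
     \<and> critical (hball - {x0})
         (\<lambda>x. (N - 1)^2 / 4 + 1 / (4 * (r x)^2) + (N - 1) * (N - 3) / 4 / (sinh (r x))^2)
     \<and> (\<forall>c > 1/4. \<not> (\<forall>u\<in>test_funs hball.
            hint (hgrad_sq u) - (N - 1)^2 / 4 * hint (\<lambda>x. (u x)^2)
              \<ge> c * hint (\<lambda>x. (u x)^2 / (r x)^2)))
     \<and> (\<forall>\<epsilon> > 0. \<forall>c > (N - 1) * (N - 3) / 4. \<not> (\<forall>u\<in>test_funs {x\<in>hball. r x < \<epsilon>}.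
            hint (hgrad_sq u) - (N - 1)^2 / 4 * hint (\<lambda>x. (u x)^2)
              \<ge> 1/4 * hint (\<lambda>x. (u x)^2 / (r x)^2)
                + c * hint (\<lambda>x. (u x)^2 / (sinh (r x))^2)))"
proof -
  interpret P: hyperbolic_pole x0
    by unfold_locales (rule o_in)
  have r: "r = P.r" by (simp add: fun_eq_iff P.r_def r_def)
  have "1 / 4 * hint (\<lambda>x. (u x)\<^sup>2 / (r x)\<^sup>2) + (N - 1) * (N - 3) / 4 * hint (\<lambda>x. (u x)\<^sup>2 / (sinh (r x))\<^sup>2)
      \<le> hint (hgrad_sq u) - (N - 1)\<^sup>2 / 4 * hint (\<lambda>x. (u x)\<^sup>2)" if "u \<in> test_funs hball" for u
    using P.hardy_inequality(2)[OF N3, of u] P.hint_hardy_pot[OF N3, of u] that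
    by (simp add: test_funs_iff_Cck r N_def)
  moreover have "critical (hball - {x0})
      (\<lambda>x. (N - 1)\<^sup>2 / 4 + 1 / (4 * (r x)\<^sup>2) + (N - 1) * (N - 3) / 4 / (sinh (r x))\<^sup>2)"
    using P.hardy_operator_critical by (simp add: hardy_pot_def P.\<Omega>_def r N_def)
  moreover note P.hardy_constant_optimal P.sinh_constant_optimal
  ultimately show ?thesis
    unfolding r N_def by (meson linorder_not_le)
qed

end
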